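(* Let $d,m,n$ be fixed positive integers and let $|\psi\rangle$ be a bipartite pure state with Schmidt distribution $P$. The optimal fidelity of distillation under local operations is $$F_{\mathrm{LO}}\bigl(|\Phi_d^+\rangle^{\otimes m},|\psi\rangle^{\otimes n}\bigr)=d^{-m}\Bigl[\min_{P'\in\mathcal P^{\downarrow}(\Sigma)}-\sum_{i\in\mathcal I}\alpha_i\sqrt{p'(i)}\Bigr]^2,$$ where $\mathcal I=\{1,\dots,\lceil\operatorname{rank}(P)^n/d^m\rceil\}$, $\alpha_i=\sum_{j=(i-1)d^m+1}^{\min\{i d^m,\operatorname{rank}(P)^n\}}\sqrt{p_n^{\downarrow}(j)}$, and $\Sigma$ is a finite alphabet with $|\Sigma|=d^m\operatorname{rank}(P)^n$. Moreover, the minimization is a convex optimization program (a convex objective over a convex set).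
   Context: $|\Phi_d^+\rangle=\frac1{\sqrt d}\sum_i|i\rangle|i\rangle\in\mathbb C^d\otimes\mathbb C^d$. If $|\psi\rangle=\sum_i\sqrt{p(i)}|u_i\rangle|v_i\rangle$ is a Schmidt decomposition, its Schmidt distribution is $P=\sum_ip(i)|i\rangle\langle i|$. $p_n^{\downarrow}$ is the vector of diagonal entries of $P^{\otimes n}$ in decreasing order. $\mathcal P^{\downarrow}(\Sigma)$ is the set of probability distributions $p'$ on $\Sigma=\{1,\dots,|\Sigma|\}$ with $p'(i)\ge p'(i+1)$. $F_{\mathrm{LO}}(|\psi\rangle,|\phi\rangle)=\max_{\mathcal E,\mathcal F}\langle\psi|(\mathcal E\otimes\mathcal F)(|\phi\rangle\langle\phi|)|\psi\rangle$ over local quantum channels (target first, seed second). *)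

theory Defs
  imports "HOL-Analysis.Analysis" "HOL-Analysis.Finite_Function_Topology"
begin

text \<open>
  The space \<open>\<complex>\<^sup>k\<close> is \<open>complex ^ 'k\<close> with \<open>k = CARD('k)\<close>. The tensor product of
  \<open>complex ^ 'a\<close> and \<open>complex ^ 'b\<close> is \<open>complex ^ ('a \<times> 'b)\<close>, and the \<open>n\<close>-th tensor power of
  \<open>complex ^ 'a\<close> is \<open>complex ^ ('n \<Rightarrow> 'a)\<close> with \<open>n = CARD('n)\<close>: a basis vector of the
  power is a choice of one basis vector per tensor factor.
\<close>

definition cinner :: "complex ^ 'k::finite \<Rightarrow> complex ^ 'k \<Rightarrow> complex" where
  "cinner u v = (\<Sum>i\<in>UNIV. cnj (u $ i) * v $ i)"

definition ketbra :: "complex ^ 'k::finite \<Rightarrow> complex ^ 'k ^ 'k" where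
  "ketbra u = (\<chi> i j. u $ i * cnj (u $ j))"

definition cscale :: "complex \<Rightarrow> complex ^ 'l::finite ^ 'k::finite \<Rightarrow> complex ^ 'l ^ 'k" where
  "cscale c A = (\<chi> i j. c * A $ i $ j)"

definition matrix_unit :: "'k::finite \<Rightarrow> 'k \<Rightarrow> complex ^ 'k ^ 'k" where
  "matrix_unit i j = axis i (axis j 1)"

definition tensor_vec ::
    "complex ^ 'a::finite \<Rightarrow> complex ^ 'b::finite \<Rightarrow> complex ^ ('a \<times> 'b)" where
  "tensor_vec u v = (\<chi> x. u $ fst x * v $ snd x)"

definition tensor_mat ::
    "complex ^ 'a::finite ^ 'a \<Rightarrow> complex ^ 'b::finite ^ 'b \<Rightarrow> complex ^ ('a \<times> 'b) ^ ('a \<times> 'b)" where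
  "tensor_mat A B = (\<chi> x y. A $ fst x $ fst y * B $ snd x $ snd y)"

definition mat_power :: "real ^ 's::finite ^ 's \<Rightarrow> real ^ ('n::finite \<Rightarrow> 's) ^ ('n \<Rightarrow> 's)" where
  "mat_power A = (\<chi> f g. \<Prod>k\<in>UNIV. A $ f k $ g k)"

text \<open>
  The tensor power of a bipartite vector, with the factors regrouped as
  (all first systems) \<open>\<otimes>\<close> (all second systems), so that it is again bipartite.
\<close>

definition bipartite_power ::
    "complex ^ ('a::finite \<times> 'b::finite) \<Rightarrow> complex ^ (('n::finite \<Rightarrow> 'a) \<times> ('n \<Rightarrow> 'b))" where
  "bipartite_power \<psi> = (\<chi> x. \<Prod>k\<in>UNIV. \<psi> $ (fst x k, snd x k))"

definition pure_state :: "complex ^ 'k::finite \<Rightarrow> bool" where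
  "pure_state \<psi> \<longleftrightarrow> norm \<psi> = 1"

definition max_entangled :: "complex ^ ('d::finite \<times> 'd)" where
  "max_entangled =
     (1 / sqrt (real CARD('d))) *\<^sub>R (\<Sum>i\<in>UNIV. tensor_vec (axis i 1) (axis i 1))"

definition orthonormal_family :: "('s::finite \<Rightarrow> complex ^ 'k::finite) \<Rightarrow> bool" where
  "orthonormal_family u \<longleftrightarrow> (\<forall>i j. cinner (u i) (u j) = (if i = j then 1 else 0))"

text \<open>Vanishing Schmidt coefficients are allowed.\<close>

definition schmidt_decomposition ::
    "complex ^ ('a::finite \<times> 'b::finite) \<Rightarrow> ('s::finite \<Rightarrow> real) \<Rightarrow> ('s \<Rightarrow> complex ^ 'a) \<Rightarrow> ('s \<Rightarrow> complex ^ 'b) \<Rightarrow> bool"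
  where
  "schmidt_decomposition \<psi> p u v \<longleftrightarrow>
     (\<forall>i. 0 \<le> p i) \<and> (\<Sum>i\<in>UNIV. p i) = 1 \<and>
     orthonormal_family u \<and> orthonormal_family v \<and>
     \<psi> = (\<Sum>i\<in>UNIV. sqrt (p i) *\<^sub>R tensor_vec (u i) (v i))"

definition schmidt_distribution :: "complex ^ ('a::finite \<times> 'b::finite) \<Rightarrow> real ^ 's::finite ^ 's \<Rightarrow> bool" where
  "schmidt_distribution \<psi> P \<longleftrightarrow>
     (\<exists>p u v. schmidt_decomposition \<psi> p u v \<and> P = (\<chi> i j. if i = j then p i else 0))"

text \<open>
  Positivity of an element of \<open>M\<^sub>k(\<complex>) \<otimes> M\<^sub>a(\<complex>)\<close>, given as a \<open>k \<times> k\<close> array of blocks \<open>X i j\<close>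
  (\<open>i, j < k\<close>). Applying \<open>E\<close> to every block is the action of \<open>id\<^sub>k \<otimes> E\<close>. The ancilla is indexed by
  natural numbers because its dimension is quantified in the definition of complete positivity.
\<close>

definition block_psd :: "nat \<Rightarrow> (nat \<Rightarrow> nat \<Rightarrow> complex ^ 'a::finite ^ 'a) \<Rightarrow> bool" where
  "block_psd k X \<longleftrightarrow>
     (\<forall>v. (\<Sum>i<k. \<Sum>j<k. cinner (v i) (X i j *v v j)) \<in> \<real>\<^sub>\<ge>\<^sub>0)"

definition completely_positive :: "(complex ^ 'a::finite ^ 'a \<Rightarrow> complex ^ 'b::finite ^ 'b) \<Rightarrow> bool" where
  "completely_positive E \<longleftrightarrow>
     (\<forall>k X. block_psd k X \<longrightarrow> block_psd k (\<lambda>i j. E (X i j)))"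

definition quantum_channel :: "(complex ^ 'a::finite ^ 'a \<Rightarrow> complex ^ 'b::finite ^ 'b) \<Rightarrow> bool" where
  "quantum_channel E \<longleftrightarrow>
     (\<forall>X Y. E (X + Y) = E X + E Y) \<and> (\<forall>c X. E (cscale c X) = cscale c (E X)) \<and>
     completely_positive E \<and> (\<forall>X. trace (E X) = trace X)"

text \<open>
  For linear \<open>E\<close> and \<open>F\<close> this is the linear map determined by
  \<open>A \<otimes> B \<mapsto> E A \<otimes> F B\<close>, written out in the basis of matrix units.
\<close>

definition tensor_map ::
    "(complex ^ 'a::finite ^ 'a \<Rightarrow> complex ^ 'c::finite ^ 'c) \<Rightarrow> (complex ^ 'b::finite ^ 'b \<Rightarrow> complex ^ 'd::finite ^ 'd)
      \<Rightarrow> complex ^ ('a \<times> 'b) ^ ('a \<times> 'b) \<Rightarrow> complex ^ ('c \<times> 'd) ^ ('c \<times> 'd)" where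
  "tensor_map E F X =
     (\<Sum>x\<in>UNIV. \<Sum>y\<in>UNIV.
        cscale (X $ x $ y)
          (tensor_mat (E (matrix_unit (fst x) (fst y))) (F (matrix_unit (snd x) (snd y)))))"

text \<open>The quadratic form below is real for channels \<open>E\<close> and \<open>F\<close>; \<open>Re\<close> only changes the type.\<close>

definition lo_fidelities ::
    "complex ^ ('c::finite \<times> 'd::finite) \<Rightarrow> complex ^ ('a::finite \<times> 'b::finite) \<Rightarrow> real set" where
  "lo_fidelities \<psi> \<phi> =
     {Re (cinner \<psi> (tensor_map E F (ketbra \<phi>) *v \<psi>)) | E F. quantum_channel E \<and> quantum_channel F}"

definition F_LO :: "complex ^ ('c::finite \<times> 'd::finite) \<Rightarrow> complex ^ ('a::finite \<times> 'b::finite) \<Rightarrow> real" where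
  "F_LO \<psi> \<phi> = Sup (lo_fidelities \<psi> \<phi>)"

text \<open>
  The \<open>j\<close>-th entry, counted from \<open>1\<close>, of the decreasing rearrangement of the diagonal of a matrix;
  meaningful for \<open>1 \<le> j \<le> CARD('k)\<close>.
\<close>

definition decreasing_diag :: "real ^ 'k::finite ^ 'k \<Rightarrow> nat \<Rightarrow> real" where
  "decreasing_diag A j =
     rev (sorted_list_of_multiset (image_mset (\<lambda>i. A $ i $ i) (mset_set UNIV))) ! (j - 1)"

text \<open>
  Distributions on \<open>{1..N}\<close> are finitely supported functions on \<open>nat\<close>, which form a real vector
  space, so that \<open>convex\<close> and \<open>convex_on\<close> apply.
\<close>

definition decreasing_distributions :: "nat \<Rightarrow> (nat \<Rightarrow>\<^sub>0 real) set" where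
  "decreasing_distributions N =
     {p. Poly_Mapping.keys p \<subseteq> {1..N} \<and> (\<forall>i\<in>{1..N}. 0 \<le> Poly_Mapping.lookup p i) \<and>
         (\<Sum>i=1..N. Poly_Mapping.lookup p i) = 1 \<and>
         (\<forall>i. 1 \<le> i \<and> i < N \<longrightarrow> Poly_Mapping.lookup p (Suc i) \<le> Poly_Mapping.lookup p i)}"

end

(*
  Upper bound: in Kraus form the fidelity is, up to the factor 1/D, the squared Frobenius norm of
  the matrix of overlaps between the two environments, where D is the dimension of each side of
  the target. After a Schmidt decomposition of that matrix, each singular value is at most a
  weighted sum of the Schmidt coefficients of the source with weights W s k, where the row sums of
  W are at most 1 and the column sums at most D. A rearrangement bound then allots the D largest
  coefficients to the largest singular value, the next D to the second, and so on; Cauchy-Schwarz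
  bounds the sum of squares by that of the block sums alpha_i.

  Attainment: both parties coherently map the i-th block of D Schmidt vectors to the standard
  basis and forget i. The minimum over P' is again Cauchy-Schwarz, attained at p'(i) proportional
  to alpha_i^2, which is decreasing because alpha is.
*)

theory Submission
  imports Defs
begin

subsection \<open>The complex inner product\<close>

text \<open>The fidelity sums over all pairs of Kraus indices of the two parties, so no pair can be
  bounded in isolation. Reading a Kraus index as the label of an environment register turns each
  channel into an isometry; the Schmidt vectors of the source then become orthonormal vectors of
  environment tensor target, and all overlaps form one matrix that is linear in the Schmidt
  coefficients. A singular value of that matrix is a sum of products of one overlap per party. The
  inequality 2yz \<le> y^2 + z^2 separates the parties, and the weight W is the resulting average.
  Both bounds on W are Bessel's inequality: 1 because a Schmidt vector is a unit vector, D because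
  the target side has D basis vectors. The quantity to bound is quadratic in the singular values
  while the estimate for each of them is linear. Applying the estimate to only one factor of each
  square makes the problem linear in W; Cauchy-Schwarz returns the other factor, which
  cancels.\<close>

lemma cinner_simps:
  "cinner (u + v) w = cinner u w + cinner v w"
  "cinner u (v + w) = cinner u v + cinner u w"
  "cinner (u - v) w = cinner u w - cinner v w"
  "cinner u (v - w) = cinner u v - cinner u w"
  "cinner (c *s u) v = cnj c * cinner u v"
  "cinner u (c *s v) = c * cinner u v"
  "cinner (r *\<^sub>R u) v = of_real r * cinner u v"
  "cinner u (r *\<^sub>R v) = of_real r * cinner u v"
  "cinner 0 v = 0" "cinner u 0 = 0"
  by (simp_all add: cinner_def algebra_simps sum.distrib sum_subtractf sum_distrib_left scaleR_conv_of_real[where 'a = complex])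

lemma cinner_sum_left: "cinner (sum f S) v = (\<Sum>i\<in>S. cinner (f i) v)"
  by (induction S rule: infinite_finite_induct) (auto simp: cinner_simps)

lemma cinner_sum_right: "cinner u (sum f S) = (\<Sum>i\<in>S. cinner u (f i))"
  by (induction S rule: infinite_finite_induct) (auto simp: cinner_simps)

lemma cnj_cinner: "cnj (cinner u v) = cinner v u"
  by (simp add: cinner_def mult.commute)

lemma cmod_cinner_commute: "cmod (cinner u v) = cmod (cinner v u)"
  by (metis cnj_cinner complex_mod_cnj)

lemma norm_squared_vec: "(norm v)\<^sup>2 = (\<Sum>i\<in>UNIV. (cmod (v $ i))\<^sup>2)"
  for v :: "complex ^ 'k::finite"
  by (simp add: norm_vec_def L2_set_def sum_nonneg)

lemma cinner_self: "cinner v v = of_real ((norm v)\<^sup>2)"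
  unfolding norm_squared_vec cinner_def of_real_sum
  by (intro sum.cong refl) (simp add: complex_norm_square mult.commute del: of_real_power)

lemma sum_UNIV_prod:
  "(\<Sum>x\<in>UNIV. f x) = (\<Sum>a\<in>UNIV. \<Sum>b\<in>UNIV. f (a, b))"
  for f :: "'a::finite \<times> 'b::finite \<Rightarrow> 'c::comm_monoid_add"
  by (simp add: sum.cartesian_product)

lemma cinner_tensor_vec:
  "cinner (tensor_vec u v) (tensor_vec u' v') = cinner u u' * cinner v v'"
  unfolding cinner_def tensor_vec_def sum_UNIV_prod by (simp add: sum_product algebra_simps)

definition orthonormal_on :: "'i set \<Rightarrow> ('i \<Rightarrow> complex ^ 'k::finite) \<Rightarrow> bool" where
  "orthonormal_on S e \<longleftrightarrow> (\<forall>i\<in>S. \<forall>j\<in>S. cinner (e i) (e j) = (if i = j then 1 else 0))"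

lemma orthonormal_family_iff_on: "orthonormal_family e \<longleftrightarrow> orthonormal_on UNIV e"
  by (simp add: orthonormal_family_def orthonormal_on_def)

lemma orthonormal_on_norm: "orthonormal_on S e \<Longrightarrow> i \<in> S \<Longrightarrow> norm (e i) = 1"
proof -
  assume "orthonormal_on S e" "i \<in> S"
  then have "complex_of_real ((norm (e i))\<^sup>2) = 1"
    by (simp only: cinner_self[symmetric] orthonormal_on_def) simp
  then have "(norm (e i))\<^sup>2 = 1" using of_real_eq_1_iff by blast
  then show ?thesis using norm_ge_zero[of "e i"] unfolding power2_eq_1_iff by linarith
qed

text \<open>\<open>w\<close> is the orthogonal projection of \<open>v\<close> onto the span of the
  family. It has the same inner products with the family as \<open>v\<close>, so the square of
  \<open>norm (v - w)\<close> is the difference of the two sides.\<close>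

lemma Bessel_inequality:
  assumes "finite S" "orthonormal_on S e"
  shows "(\<Sum>i\<in>S. (cmod (cinner (e i) v))\<^sup>2) \<le> (norm v)\<^sup>2"
proof -
  define w where "w = (\<Sum>i\<in>S. cinner (e i) v *s e i)"
  have ew: "cinner (e i) w = cinner (e i) v" if "i \<in> S" for i
  proof -
    have "cinner (e i) w = (\<Sum>j\<in>S. cinner (e j) v * cinner (e i) (e j))"
      by (simp add: w_def cinner_sum_right cinner_simps)
    also have "\<dots> = (\<Sum>j\<in>S. if j = i then cinner (e j) v else 0)"
      using assms(2) that by (intro sum.cong) (auto simp: orthonormal_on_def)
    finally show ?thesis using assms(1) that by (simp add: sum.delta)
  qed
  let ?b = "\<Sum>i\<in>S. (cmod (cinner (e i) v))\<^sup>2"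
  have wx: "cinner w x = (\<Sum>i\<in>S. cnj (cinner (e i) v) * cinner (e i) x)" for x
    by (simp add: w_def cinner_sum_left cinner_simps)
  have wv: "cinner w v = of_real ?b"
    unfolding wx of_real_sum
    by (intro sum.cong refl) (metis complex_norm_square mult.commute of_real_power)
  have ww: "cinner w w = of_real ?b"
    using wv ew unfolding wx by simp
  have vw: "cinner v w = of_real ?b"
    by (metis wv cnj_cinner complex_cnj_complex_of_real)
  have "of_real ((norm (v - w))\<^sup>2) = complex_of_real ((norm v)\<^sup>2 - ?b)"
    unfolding cinner_self[symmetric] of_real_diff
    by (simp add: cinner_simps wv ww vw)
  then have "(norm (v - w))\<^sup>2 = (norm v)\<^sup>2 - ?b" using of_real_eq_iff by blast
  then show ?thesis by (metis diff_ge_0_iff_ge zero_le_power2)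
qed

text \<open>The squared norms of the family, summed coordinatewise, are overlaps with the standard
  basis; Bessel's inequality for each basis vector caps the count by the dimension.\<close>

lemma orthonormal_on_card_le:
  assumes "finite S" "orthonormal_on S (e :: 'i \<Rightarrow> complex ^ 'k::finite)"
  shows "card S \<le> CARD('k)"
proof -
  have "real (card S) = (\<Sum>i\<in>S. (norm (e i))\<^sup>2)"
    using assms orthonormal_on_norm by fastforce
  also have "\<dots> = (\<Sum>x\<in>UNIV. \<Sum>i\<in>S. (cmod (cinner (e i) (axis x 1)))\<^sup>2)"
    unfolding norm_squared_vec
    by (subst sum.swap) (simp add: cinner_def axis_def if_distrib cong: if_cong)
  also have "\<dots> \<le> (\<Sum>x\<in>(UNIV :: 'k set). (norm (axis x 1 :: complex ^ 'k))\<^sup>2)"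
    by (intro sum_mono Bessel_inequality assms)
  also have "\<dots> = real CARD('k)" by simp
  finally show ?thesis by simp
qed

subsection \<open>Schmidt decomposition by deflation\<close>

lemma continuous_on_cinner [continuous_intros]:
  assumes "continuous_on S f" "continuous_on S g"
  shows "continuous_on S (\<lambda>x. cinner (f x) (g x))"
  unfolding cinner_def by (intro continuous_intros assms)

lemma continuous_on_tensor_vec [continuous_intros]:
  assumes "continuous_on S f" "continuous_on S g"
  shows "continuous_on S (\<lambda>x. tensor_vec (f x) (g x))"
  unfolding tensor_vec_def by (intro continuous_intros assms)

text \<open>Partial inner product: the vector that represents
  \<open>\<lambda>f. cinner (tensor_vec e f) M\<close>. With \<open>M\<close> read as a matrix, its
  first index is contracted against the conjugate of \<open>e\<close>.\<close>

definition partial_left :: "complex ^ 'a::finite \<Rightarrow> complex ^ ('a \<times> 'b::finite) \<Rightarrow> complex ^ 'b" where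
  "partial_left e M = (\<chi> b. \<Sum>a\<in>UNIV. cnj (e $ a) * M $ (a, b))"

definition partial_right :: "complex ^ 'b::finite \<Rightarrow> complex ^ ('a::finite \<times> 'b) \<Rightarrow> complex ^ 'a" where
  "partial_right f M = (\<chi> a. \<Sum>b\<in>UNIV. cnj (f $ b) * M $ (a, b))"

lemma cinner_tensor_partial_left: "cinner (tensor_vec e f) M = cinner f (partial_left e M)"
  unfolding cinner_def tensor_vec_def partial_left_def sum_UNIV_prod
  by (subst sum.swap) (simp add: sum_distrib_left algebra_simps)

lemma cinner_tensor_partial_right: "cinner (tensor_vec e f) M = cinner e (partial_right f M)"
  unfolding cinner_def tensor_vec_def partial_right_def sum_UNIV_prod
  by (simp add: sum_distrib_left algebra_simps)

lemma partial_diff: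
  "partial_left e (M - N) = partial_left e M - partial_left e N"
  "partial_right f (M - N) = partial_right f M - partial_right f N"
  by (simp_all add: partial_left_def partial_right_def vec_eq_iff algebra_simps sum_subtractf)

lemma partial_scaleR_tensor:
  "partial_left e (r *\<^sub>R tensor_vec u v) = r *\<^sub>R (cinner e u *s v)"
  "partial_right f (r *\<^sub>R tensor_vec u v) = r *\<^sub>R (cinner f v *s u)"
  by (simp_all add: partial_left_def partial_right_def vec_eq_iff cinner_def tensor_vec_def
    sum_distrib_left sum_distrib_right algebra_simps scaleR_conv_of_real[where 'a = complex])

lemma norm_tensor_vec: "norm (tensor_vec u v) = norm u * norm v"
proof -
  have "complex_of_real ((norm (tensor_vec u v))\<^sup>2) = of_real ((norm u * norm v)\<^sup>2)"
    by (simp only: cinner_self[symmetric] cinner_tensor_vec power_mult_distrib of_real_mult)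
  then have "(norm (tensor_vec u v))\<^sup>2 = (norm u * norm v)\<^sup>2" using of_real_eq_iff by blast
  then show ?thesis by (simp add: power2_eq_iff_nonneg)
qed

lemma tensor_vec_smult_left: "tensor_vec (c *s u) v = c *s tensor_vec u v"
  by (simp add: tensor_vec_def vec_eq_iff)

lemma norm_smult: "norm (c *s v) = cmod c * norm v" for v :: "complex ^ 'k::finite"
  by (simp add: norm_vec_def L2_set_def norm_mult power_mult_distrib sum_distrib_left[symmetric]
      real_sqrt_mult)

lemma cinner_axis: "cinner (axis i 1) v = v $ i"
proof -
  have "cinner (axis i 1) v = (\<Sum>j\<in>UNIV. if j = i then v $ j else 0)"
    unfolding cinner_def by (intro sum.cong) (auto simp: axis_def)
  then show ?thesis by simp
qed

lemma tensor_vec_axis: "tensor_vec (axis a 1) (axis b 1) = axis (a, b) 1"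
  by (auto simp: tensor_vec_def vec_eq_iff axis_def)

lemma cinner_tensor_axis: "cinner (tensor_vec (axis a 1) (axis b 1)) M = M $ (a, b)"
  by (simp add: tensor_vec_axis cinner_axis)

text \<open>Equality case of Cauchy-Schwarz: comparison with the normalised \<open>v\<close> gives
  \<open>norm v \<le> Re (cinner f v)\<close>, while the squared distance from \<open>v\<close> to
  its projection on \<open>f\<close> is the square of the left side minus that of the right.\<close>

lemma sphere_maximizer_eq:
  fixes v f :: "complex ^ 'k::finite"
  assumes f: "norm f = 1" and max: "\<And>g. norm g = 1 \<Longrightarrow> Re (cinner g v) \<le> Re (cinner f v)"
  shows "v = Re (cinner f v) *\<^sub>R f"
proof -
  have le: "norm v \<le> Re (cinner f v)"
  proof (cases "v = 0")
    case False
    have "Re (cinner ((1 / norm v) *\<^sub>R v) v) \<le> Re (cinner f v)"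
      by (rule max) (use False in simp)
    moreover have "Re (cinner ((1 / norm v) *\<^sub>R v) v) = norm v"
      using False by (simp add: cinner_simps cinner_self power2_eq_square)
    ultimately show ?thesis by simp
  qed (simp add: cinner_simps)
  let ?r = "Re (cinner f v)"
  have "Re (cinner v f) = ?r" by (metis cnj_cinner cnj.simps(1))
  have "(norm (v - ?r *\<^sub>R f))\<^sup>2 = Re (cinner (v - ?r *\<^sub>R f) (v - ?r *\<^sub>R f))"
    by (simp add: cinner_self)
  also have "\<dots> = (norm v)\<^sup>2 - ?r\<^sup>2"
    using f \<open>Re (cinner v f) = ?r\<close>
    by (simp add: cinner_simps cinner_self[of v] cinner_self[of f] power2_eq_square)
  also have "\<dots> \<le> 0" using power_mono[OF le, of 2] by simp
  finally show ?thesis by simp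
qed

text \<open>A maximiser of the real overlap over the compact product of unit spheres also maximises
  in each slot separately, which yields both singular vector equations. The last conclusion lets
  deflation stop only when the residual vanishes.\<close>

lemma top_singular_pair:
  fixes M :: "complex ^ ('a::finite \<times> 'b::finite)"
  obtains e f r where "norm e = 1" "norm f = 1" "0 \<le> r"
    "partial_left e M = r *\<^sub>R f" "partial_right f M = r *\<^sub>R e" "r = 0 \<Longrightarrow> M = 0"
proof -
  let ?S = "sphere (0::complex ^ 'a) 1 \<times> sphere (0::complex ^ 'b) 1"
  let ?g = "\<lambda>z. Re (cinner (tensor_vec (fst z) (snd z)) M)"
  have ax: "norm (axis i (1::complex)) = 1" for i :: "'k::finite" by simp
  have "compact ?S" by (intro compact_Times compact_sphere)
  moreover have "?S \<noteq> {}"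
    using ax[of "undefined :: 'a"] ax[of "undefined :: 'b"] by (force simp: dist_norm)
  moreover have "continuous_on ?S ?g" by (intro continuous_intros)
  ultimately obtain z where z: "z \<in> ?S" "\<forall>y\<in>?S. ?g y \<le> ?g z"
    using continuous_attains_sup by blast
  obtain e f where ef: "z = (e, f)" by (cases z)
  have e: "norm e = 1" and f: "norm f = 1" using z(1) ef by (auto simp: dist_norm)
  let ?r = "Re (cinner (tensor_vec e f) M)"
  have max: "Re (cinner (tensor_vec e' f') M) \<le> ?r" if "norm e' = 1" "norm f' = 1" for e' f'
  proof -
    have "(e', f') \<in> ?S" using that by simp
    from bspec[OF z(2) this] have "?g (e', f') \<le> ?g z" .
    then show ?thesis by (simp add: ef)
  qed
  have max0: "M = 0" if "?r = 0"
  proof -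
    have "M $ (a, b) = 0" for a b
    proof (rule ccontr)
      let ?x = "M $ (a, b)"
      \<comment> \<open>The phase of the entry: \<open>cnj c * ?x\<close> is its modulus, so a
        nonzero entry would give a product vector with positive overlap.\<close>
      define c where "c = sgn ?x"
      assume nz: "?x \<noteq> 0"
      have c: "cmod c = 1" using nz by (simp add: c_def norm_sgn)
      have "cinner (tensor_vec (c *s axis a 1) (axis b 1)) M = cnj c * ?x"
        by (simp add: tensor_vec_smult_left cinner_simps cinner_tensor_axis)
      also have "\<dots> = of_real (cmod ?x) * (c * cnj c)"
        using nz by (simp add: c_def sgn_eq)
      also have "\<dots> = cmod ?x"
        using c by (simp add: complex_norm_square[symmetric])
      finally have "Re (cinner (tensor_vec (c *s axis a 1) (axis b 1)) M) = cmod ?x"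
        by simp
      moreover have "norm (c *s (axis a 1 :: complex ^ 'a)) = 1"
        using c by (simp add: norm_smult)
      ultimately show False using max[of "c *s axis a 1" "axis b 1"] that nz by simp
    qed
    then show "M = 0" by (simp add: vec_eq_iff split_paired_all)
  qed
  have "?r \<ge> 0"
  proof -
    \<comment> \<open>Negating \<open>e\<close> negates the overlap, so the maximum cannot be
      negative.\<close>
    have "Re (cinner (tensor_vec (- e) f) M) \<le> ?r" using e f by (intro max) auto
    moreover have "tensor_vec (- e) f = (-1) *\<^sub>R tensor_vec e f" by (simp add: tensor_vec_def vec_eq_iff)
    ultimately show ?thesis by (simp only: cinner_simps) simp
  qed
  moreover have "partial_left e M = ?r *\<^sub>R f"
    using sphere_maximizer_eq[of f "partial_left e M"] max e f
    by (simp add: cinner_tensor_partial_left)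
  moreover have "partial_right f M = ?r *\<^sub>R e"
    using sphere_maximizer_eq[of e "partial_right f M"] max e f
    by (simp add: cinner_tensor_partial_right)
  ultimately show ?thesis using that e f max0 by blast
qed

text \<open>Each step subtracts the leading singular term of the residual. The invariant that the
  vectors found so far annihilate the residual from both sides forces the next pair to be orthogonal
  to them. The second alternative records that the residual vanished after some number of
  steps.\<close>

lemma schmidt_deflation:
  fixes M :: "complex ^ ('a::finite \<times> 'b::finite)" and k :: nat
  shows "(\<exists>e f \<sigma>. orthonormal_on {..<k} e \<and> orthonormal_on {..<k} f \<and> (\<forall>i<k. 0 \<le> \<sigma> i) \<and>
     (\<forall>i<k. partial_left (e i) (M - (\<Sum>i<k. \<sigma> i *\<^sub>R tensor_vec (e i) (f i))) = 0) \<and>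
     (\<forall>i<k. partial_right (f i) (M - (\<Sum>i<k. \<sigma> i *\<^sub>R tensor_vec (e i) (f i))) = 0))
   \<or> (\<exists>l e f \<sigma>. orthonormal_on {..<l::nat} e \<and> orthonormal_on {..<l} f \<and> (\<forall>i<l. 0 \<le> \<sigma> i) \<and>
       M = (\<Sum>i<l. \<sigma> i *\<^sub>R tensor_vec (e i) (f i)))" (is "_ \<or> ?B")
proof (induction k)
  case 0
  show ?case by (intro disjI1 exI) (simp add: orthonormal_on_def)
next
  case (Suc k)
  show ?case
  proof (cases ?B)
    case False
    with Suc obtain e f \<sigma> where e: "orthonormal_on {..<k} e" and f: "orthonormal_on {..<k} f"
      and \<sigma>: "\<forall>i<k. 0 \<le> \<sigma> i"
      and L: "\<forall>i<k. partial_left (e i) (M - (\<Sum>i<k. \<sigma> i *\<^sub>R tensor_vec (e i) (f i))) = 0"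
      and R: "\<forall>i<k. partial_right (f i) (M - (\<Sum>i<k. \<sigma> i *\<^sub>R tensor_vec (e i) (f i))) = 0"
      by blast
    define r where "r = M - (\<Sum>i<k. \<sigma> i *\<^sub>R tensor_vec (e i) (f i))"
    obtain e' f' s where n: "norm e' = 1" "norm f' = 1" "0 \<le> s"
      and l: "partial_left e' r = s *\<^sub>R f'" and ri: "partial_right f' r = s *\<^sub>R e'"
      and s0: "s = 0 \<Longrightarrow> r = 0"
      using top_singular_pair by blast
    have L': "partial_left (e i) r = 0" and R': "partial_right (f i) r = 0" if "i < k" for i
      using L R that unfolding r_def by blast+
    have "r \<noteq> 0"
    proof
      assume "r = 0"
      then have "M = (\<Sum>i<k. \<sigma> i *\<^sub>R tensor_vec (e i) (f i))" by (simp add: r_def)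
      with False e f \<sigma> show False by blast
    qed
    with s0 n have s: "s > 0" by (cases "s = 0") auto
    \<comment> \<open>Contracting \<open>r\<close> with \<open>f'\<close> first gives
      \<open>s\<close> times the overlap, contracting with \<open>e i\<close> first gives zero;
      \<open>s > 0\<close> permits cancelling.\<close>
    have oe: "cinner (e i) e' = 0" if "i < k" for i
    proof -
      have "of_real s * cinner (e i) e' = cinner (tensor_vec (e i) f') r"
        by (simp add: cinner_tensor_partial_right ri cinner_simps)
      also have "\<dots> = 0" using L'[OF that] by (simp add: cinner_tensor_partial_left cinner_simps)
      finally show ?thesis using s by simp
    qed
    have off: "cinner (f i) f' = 0" if "i < k" for i
    proof -
      have "of_real s * cinner (f i) f' = cinner (tensor_vec e' (f i)) r"
        by (simp add: cinner_tensor_partial_left l cinner_simps)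
      also have "\<dots> = 0" using R'[OF that] by (simp add: cinner_tensor_partial_right cinner_simps)
      finally show ?thesis using s by simp
    qed
    have oe': "cinner e' (e i) = 0" "cinner f' (f i) = 0" if "i < k" for i
      using oe[OF that] off[OF that] by (metis cnj_cinner complex_cnj_zero)+
    let ?e = "e(k := e')" and ?f = "f(k := f')" and ?\<sigma> = "\<sigma>(k := s)"
    have r': "M - (\<Sum>i<Suc k. ?\<sigma> i *\<^sub>R tensor_vec (?e i) (?f i)) = r - s *\<^sub>R tensor_vec e' f'"
      by (simp add: r_def algebra_simps)
    have 1: "orthonormal_on {..<Suc k} ?e" "orthonormal_on {..<Suc k} ?f"
      using e f oe off oe' cinner_self[of e'] cinner_self[of f'] n
      by (auto simp: orthonormal_on_def less_Suc_eq)
    have 2: "\<forall>i<Suc k. partial_left (?e i) (M - (\<Sum>i<Suc k. ?\<sigma> i *\<^sub>R tensor_vec (?e i) (?f i))) = 0"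
      unfolding r' using L' oe l n cinner_self[of e']
      by (auto simp: less_Suc_eq partial_diff partial_scaleR_tensor)
    have 3: "\<forall>i<Suc k. partial_right (?f i) (M - (\<Sum>i<Suc k. ?\<sigma> i *\<^sub>R tensor_vec (?e i) (?f i))) = 0"
      unfolding r' using R' off ri n cinner_self[of f']
      by (auto simp: less_Suc_eq partial_diff partial_scaleR_tensor)
    have 4: "\<forall>i<Suc k. 0 \<le> ?\<sigma> i" using \<sigma> s by (simp add: less_Suc_eq)
    show ?thesis
      by (intro disjI1 exI[of _ ?e] exI[of _ ?f] exI[of _ ?\<sigma>] conjI 1 2 3 4)
  next
    case True
    then show ?thesis by (rule disjI2)
  qed
qed

text \<open>One step more than the dimension of the first factor would produce too large an
  orthonormal family, so deflation must have terminated.\<close>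

lemma schmidt_decomposition_exists:
  fixes M :: "complex ^ ('a::finite \<times> 'b::finite)"
  shows "\<exists>l e f \<sigma>. orthonormal_on {..<l::nat} e \<and> orthonormal_on {..<l} f \<and> (\<forall>i<l. 0 \<le> \<sigma> i) \<and>
       M = (\<Sum>i<l. \<sigma> i *\<^sub>R tensor_vec (e i) (f i))"
proof -
  have "\<not> orthonormal_on {..<Suc CARD('a)} (e :: nat \<Rightarrow> complex ^ 'a)" for e
    using orthonormal_on_card_le[of "{..<Suc CARD('a)}" e] by auto
  with schmidt_deflation[where k = "Suc CARD('a)" and M = M]
  show ?thesis by (elim disjE exE conjE) (simp, blast)
qed

subsection \<open>Rearrangement\<close>

text \<open>Summation by parts: a decreasing nonnegative weight is a nonnegative combination of
  indicators of initial segments, on which the partial sums compare.\<close>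

lemma Abel_majorization:
  fixes g h w :: "nat \<Rightarrow> real"
  assumes "antimono w" "\<And>j. 0 \<le> w j"
    and "\<And>l. l \<le> n \<Longrightarrow> (\<Sum>j<l. g j) \<le> (\<Sum>j<l. h j)"
  shows "(\<Sum>j<n. w j * g j) \<le> (\<Sum>j<n. w j * h j)"
proof -
  \<comment> \<open>Keeping the boundary term makes the induction close; it is nonnegative and is
    dropped afterwards.\<close>
  have "w n * (\<Sum>j<n. h j - g j) \<le> (\<Sum>j<n. w j * (h j - g j))"
    using assms(3)
  proof (induction n)
    case (Suc n)
    let ?S = "\<lambda>n. \<Sum>j<n. h j - g j"
    have "w (Suc n) * ?S (Suc n) \<le> w n * ?S (Suc n)"
      using Suc.prems[of "Suc n"] assms(1)
      by (intro mult_right_mono) (auto simp: antimono_def sum_subtractf)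
    also have "\<dots> = w n * ?S n + w n * (h n - g n)" by (simp add: algebra_simps)
    also have "\<dots> \<le> (\<Sum>j<Suc n. w j * (h j - g j))" using Suc by simp
    finally show ?case .
  qed simp
  moreover have "0 \<le> w n * (\<Sum>j<n. h j - g j)"
    using assms(3)[of n] assms(2) by (simp add: sum_subtractf)
  ultimately show ?thesis by (simp add: algebra_simps sum_subtractf)
qed

text \<open>The right-hand side is the value of the greedy transport plan, which sends row \<open>j\<close> to column
  \<open>j div D\<close>.\<close>

lemma transport_bound:
  fixes w \<sigma> :: "nat \<Rightarrow> real" and W :: "nat \<Rightarrow> nat \<Rightarrow> real" and D :: nat
  assumes w: "antimono w" "\<And>j. 0 \<le> w j"
    and \<sigma>: "antimono \<sigma>" "\<And>k. 0 \<le> \<sigma> k" "\<And>k. L \<le> k \<Longrightarrow> \<sigma> k = 0"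
    and W: "\<And>j k. 0 \<le> W j k"
    and row: "\<And>j. j < T \<Longrightarrow> (\<Sum>k<L. W j k) \<le> 1"
    and col: "\<And>k. k < L \<Longrightarrow> (\<Sum>j<T. W j k) \<le> D"
    and D: "D > 0"
  shows "(\<Sum>j<T. w j * (\<Sum>k<L. \<sigma> k * W j k)) \<le> (\<Sum>j<T. w j * \<sigma> (j div D))"
proof (rule Abel_majorization[OF w])
  fix l assume l: "l \<le> T"
  let ?H = "\<lambda>k. \<Sum>j<l. if j div D = k then 1 else 0 :: real"
  have "(\<Sum>j<l. \<Sum>k<L. \<sigma> k * W j k) = (\<Sum>k<L. \<sigma> k * (\<Sum>j<l. W j k))"
    by (subst sum.swap) (simp add: sum_distrib_left)
  also have "\<dots> \<le> (\<Sum>k<L. \<sigma> k * ?H k)"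
  proof (rule Abel_majorization[OF \<sigma>(1,2)])
    \<comment> \<open>A corner of \<open>l\<close> rows and \<open>K\<close> columns carries at most
      \<open>l\<close> by the row sums and at most \<open>K * D\<close> by the column sums; the
      greedy plan attains the smaller of the two.\<close>
    fix K assume K: "K \<le> L"
    have "(\<Sum>k<K. \<Sum>j<l. W j k) = (\<Sum>j<l. \<Sum>k<K. W j k)" by (rule sum.swap)
    also have "\<dots> \<le> (\<Sum>j<l. 1)"
    proof (rule sum_mono)
      fix j assume "j \<in> {..<l}"
      then have "(\<Sum>k<L. W j k) \<le> 1" using row l by simp
      moreover have "(\<Sum>k<K. W j k) \<le> (\<Sum>k<L. W j k)"
        by (intro sum_mono2) (use K W in auto)
      ultimately show "(\<Sum>k<K. W j k) \<le> 1" by linarith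
    qed
    finally have 1: "(\<Sum>k<K. \<Sum>j<l. W j k) \<le> real l" by simp
    have "(\<Sum>k<K. \<Sum>j<l. W j k) \<le> (\<Sum>k<K. real D)"
    proof (rule sum_mono)
      fix k assume "k \<in> {..<K}"
      then have "(\<Sum>j<T. W j k) \<le> D" using col K by simp
      moreover have "(\<Sum>j<l. W j k) \<le> (\<Sum>j<T. W j k)"
        by (intro sum_mono2) (use l W in auto)
      ultimately show "(\<Sum>j<l. W j k) \<le> real D" by linarith
    qed
    then have 2: "(\<Sum>k<K. \<Sum>j<l. W j k) \<le> real (K * D)" by simp
    have "(\<Sum>k<K. ?H k) = (\<Sum>j<l. \<Sum>k<K. if j div D = k then 1 else 0)" by (rule sum.swap)
    also have "\<dots> = (\<Sum>j<l. if j < K * D then 1 else 0)"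
      using D by (intro sum.cong) (auto simp: div_less_iff_less_mult)
    also have "\<dots> = real (card ({..<l} \<inter> {..<K * D}))"
      by (simp add: sum.If_cases lessThan_def)
    also have "{..<l} \<inter> {..<K * D} = {..<min l (K * D)}" by auto
    finally have "(\<Sum>k<K. ?H k) = real (min l (K * D))" by simp
    with 1 2 show "(\<Sum>k<K. \<Sum>j<l. W j k) \<le> (\<Sum>k<K. ?H k)" by (simp add: min_def)
  qed
  also have "\<dots> = (\<Sum>j<l. \<Sum>k<L. \<sigma> k * (if j div D = k then 1 else 0))"
    by (subst sum.swap) (simp add: sum_distrib_left)
  also have "\<dots> = (\<Sum>j<l. \<sigma> (j div D))"
    using \<sigma>(3) by (intro sum.cong) (auto simp: if_distrib not_less cong: if_cong)
  finally show "(\<Sum>j<l. \<Sum>k<L. \<sigma> k * W j k) \<le> (\<Sum>j<l. \<sigma> (j div D))" .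
qed

text \<open>The third conclusion matches the enumeration with the list inside
  \<open>decreasing_diag\<close>: the values agree although ties leave the enumeration itself
  ambiguous.\<close>

lemma decreasing_enumeration:
  fixes f :: "'a \<Rightarrow> real"
  assumes "finite A"
  obtains b where "bij_betw b {..<card A} A" "\<And>i j. i \<le> j \<Longrightarrow> j < card A \<Longrightarrow> f (b j) \<le> f (b i)"
    "map (f \<circ> b) [0..<card A] = rev (sorted_list_of_multiset (image_mset f (mset_set A)))"
proof -
  obtain xs where xs: "set xs = A" "distinct xs" using assms finite_distinct_list by blast
  define ys where "ys = rev (sort_key f xs)"
  have ys: "set ys = A" "distinct ys" "length ys = card A"
    using xs by (auto simp: ys_def distinct_card)
  have m: "map f ys = rev (sorted_list_of_multiset (image_mset f (mset_set A)))"
  proof -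
    have "mset (map f (sort_key f xs)) = image_mset f (mset_set A)"
      using xs by (simp add: mset_set_set[symmetric])
    then have "map f (sort_key f xs) = sorted_list_of_multiset (image_mset f (mset_set A))"
      by (metis sorted_list_of_multiset_mset sorted_sort_key sorted_sort_id)
    then show ?thesis by (simp add: ys_def rev_map[symmetric])
  qed
  show ?thesis
  proof
    show "bij_betw ((!) ys) {..<card A} A" using ys by (simp add: bij_betw_nth)
    show "f (ys ! j) \<le> f (ys ! i)" if "i \<le> j" "j < card A" for i j
    proof -
      have "sorted (rev (map f ys))" by (simp add: ys_def rev_map)
      from sorted_rev_nth_mono[OF this that(1)] show ?thesis using that ys by simp
    qed
    have "map (f \<circ> (!) ys) [0..<card A] = map f ys"
      using ys(3) by (metis map_map map_nth)
    with m show "map (f \<circ> (!) ys) [0..<card A]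
        = rev (sorted_list_of_multiset (image_mset f (mset_set A)))" by simp
  qed
qed

text \<open>Counted from zero, this is the coefficient \<open>\<alpha> (Suc i)\<close> once
  \<open>w\<close> lists the square roots in decreasing order. Selecting by \<open>j div D\<close>
  needs no divisibility of \<open>T\<close> by \<open>D\<close>: the last block may be short and
  later ones are zero.\<close>

definition block_sum :: "nat \<Rightarrow> (nat \<Rightarrow> real) \<Rightarrow> nat \<Rightarrow> nat \<Rightarrow> real" where
  "block_sum D w T i = (\<Sum>j<T. if j div D = i then w j else 0)"

text \<open>\<open>j div D \<le> j\<close> puts every block index below \<open>T\<close>, so
  grouping by blocks loses no term.\<close>

lemma sum_mult_block:
  "(\<Sum>j<T. w j * \<sigma> (j div D)) = (\<Sum>i<T. block_sum D w T i * \<sigma> i)"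
proof -
  have "(\<Sum>i<T. block_sum D w T i * \<sigma> i) = (\<Sum>j<T. \<Sum>i<T. if j div D = i then w j * \<sigma> i else 0)"
    unfolding block_sum_def sum_distrib_right
    by (subst sum.swap) (intro sum.cong refl; simp)
  also have "\<dots> = (\<Sum>j<T. w j * \<sigma> (j div D))"
  proof (intro sum.cong refl)
    fix j assume "j \<in> {..<T}"
    then have "j div D < T" using le_less_trans[OF div_le_dividend[of j D]] by simp
    then show "(\<Sum>i<T. if j div D = i then w j * \<sigma> i else 0) = w j * \<sigma> (j div D)" by simp
  qed
  finally show ?thesis by (rule sym)
qed

lemma square_sum_bound:
  fixes q :: "'s::finite \<Rightarrow> real" and W :: "'s \<Rightarrow> nat \<Rightarrow> real" and \<sigma> :: "nat \<Rightarrow> real"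
  assumes b: "bij_betw b {..<CARD('s)} UNIV"
      "\<And>i j. i \<le> j \<Longrightarrow> j < CARD('s) \<Longrightarrow> q (b j) \<le> q (b i)"
    and q: "\<And>s. 0 \<le> q s" and W: "\<And>s k. 0 \<le> W s k" and \<sigma>: "\<And>k. k < L \<Longrightarrow> 0 \<le> \<sigma> k"
    and row: "\<And>s. (\<Sum>k<L. W s k) \<le> 1"
    and col: "\<And>k. k < L \<Longrightarrow> (\<Sum>s\<in>UNIV. W s k) \<le> D" and D: "D > 0"
    and le: "\<And>k. k < L \<Longrightarrow> \<sigma> k \<le> (\<Sum>s\<in>UNIV. q s * W s k)"
  shows "(\<Sum>k<L. (\<sigma> k)\<^sup>2) \<le> (\<Sum>i<CARD('s). (block_sum D (q \<circ> b) CARD('s) i)\<^sup>2)"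
proof -
  let ?T = "CARD('s)"
  obtain c where c: "bij_betw c {..<L} {..<L}" "\<And>i j. i \<le> j \<Longrightarrow> j < L \<Longrightarrow> \<sigma> (c j) \<le> \<sigma> (c i)"
    by (rule decreasing_enumeration[of "{..<L}" \<sigma>, unfolded card_lessThan]) simp_all
  have c_lt: "c k < L" if "k < L" for k using c(1) that by (auto simp: bij_betw_def)
  \<comment> \<open>Extension by zero makes both lists decreasing on all of \<open>nat\<close>. The
    second one also sorts \<sigma>, about whose order nothing is assumed.\<close>
  define w where "w j = (if j < ?T then q (b j) else 0)" for j
  define \<tau> where "\<tau> k = (if k < L then \<sigma> (c k) else 0)" for k
  have w: "antimono w" "\<And>j. 0 \<le> w j"
    using b(2) q by (auto simp: antimono_def w_def)
  have \<tau>: "antimono \<tau>" "\<And>j. 0 \<le> \<tau> j" "\<And>k. L \<le> k \<Longrightarrow> \<tau> k = 0"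
    using c(2) \<sigma> c_lt by (auto simp: antimono_def \<tau>_def)
  let ?B = "block_sum D w ?T"
  have B: "?B = block_sum D (q \<circ> b) ?T"
    by (auto simp: block_sum_def w_def fun_eq_iff intro!: sum.cong)
  let ?N = "\<Sum>k<L. (\<sigma> k)\<^sup>2"
  have N: "?N = (\<Sum>k<L. (\<tau> k)\<^sup>2)"
    using sum.reindex_bij_betw[OF c(1), of "\<lambda>k. (\<sigma> k)\<^sup>2"] by (simp add: \<tau>_def)
  have "?N \<le> (\<Sum>k<L. \<sigma> k * (\<Sum>s\<in>UNIV. q s * W s k))"
    using le \<sigma> by (intro sum_mono) (auto simp: power2_eq_square intro!: mult_left_mono)
  also have "\<dots> = (\<Sum>s\<in>UNIV. q s * (\<Sum>k<L. \<sigma> k * W s k))"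
    by (simp add: sum_distrib_left mult.left_commute) (rule sum.swap)
  also have "\<dots> = (\<Sum>j<?T. w j * (\<Sum>k<L. \<sigma> k * W (b j) k))"
    by (subst sum.reindex_bij_betw[OF b(1), symmetric]) (simp add: w_def)
  also have "\<dots> = (\<Sum>j<?T. w j * (\<Sum>k<L. \<tau> k * W (b j) (c k)))"
    by (subst sum.reindex_bij_betw[OF c(1), symmetric]) (simp add: \<tau>_def)
  also have "\<dots> \<le> (\<Sum>j<?T. w j * \<tau> (j div D))"
  proof (rule transport_bound[OF w \<tau>(1,2,3) _ _ _ D])
    show "(\<Sum>k<L. W (b j) (c k)) \<le> 1" for j
      using row[of "b j"] sum.reindex_bij_betw[OF c(1), of "W (b j)"] by simp
    show "(\<Sum>j<?T. W (b j) (c k)) \<le> real D" if "k < L" for k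
      using col[OF c_lt[OF that]] sum.reindex_bij_betw[OF b(1), of "\<lambda>s. W s (c k)"] by simp
  qed (use W in auto)
  also have "\<dots> = (\<Sum>i<?T. ?B i * \<tau> i)" by (rule sum_mult_block)
  also have "\<dots> \<le> sqrt (\<Sum>i<?T. (?B i)\<^sup>2) * sqrt (\<Sum>i<?T. (\<tau> i)\<^sup>2)"
  proof -
    have "?B i * \<tau> i \<le> \<bar>?B i\<bar> * \<bar>\<tau> i\<bar>" for i by (metis abs_ge_self abs_mult)
    then have "(\<Sum>i<?T. ?B i * \<tau> i) \<le> (\<Sum>i<?T. \<bar>?B i\<bar> * \<bar>\<tau> i\<bar>)" by (rule sum_mono)
    also have "\<dots> \<le> L2_set ?B {..<?T} * L2_set \<tau> {..<?T}" by (rule L2_set_mult_ineq)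
    finally show ?thesis by (simp only: L2_set_def)
  qed
  also have "\<dots> \<le> sqrt (\<Sum>i<?T. (?B i)\<^sup>2) * sqrt ?N"
  proof -
    \<comment> \<open>\<open>L\<close> may lie on either side of \<open>?T\<close>; summing up to
      \<open>?T + L\<close> covers both cases because \<open>\<tau>\<close> vanishes from
      \<open>L\<close> on.\<close>
    have "(\<Sum>i<?T. (\<tau> i)\<^sup>2) \<le> (\<Sum>i<?T + L. (\<tau> i)\<^sup>2)" by (intro sum_mono2) auto
    also have "\<dots> = (\<Sum>i<L. (\<tau> i)\<^sup>2)"
      by (intro sum.mono_neutral_right) (auto simp: \<tau>_def)
    finally show ?thesis unfolding N by (intro mult_left_mono) (auto simp: sum_nonneg)
  qed
  finally have *: "?N \<le> sqrt (\<Sum>i<?T. (?B i)\<^sup>2) * sqrt ?N" .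
  have N0: "0 \<le> ?N" by (simp add: sum_nonneg)
  have "sqrt ?N \<le> sqrt (\<Sum>i<?T. (?B i)\<^sup>2)"
  \<comment> \<open>Cancelling \<open>sqrt ?N\<close> needs it positive; otherwise the left side is
    zero.\<close>
  proof (cases "?N = 0")
    case False
    with N0 have p: "sqrt ?N > 0" by simp
    have m: "sqrt ?N * sqrt ?N \<le> sqrt (\<Sum>i<?T. (?B i)\<^sup>2) * sqrt ?N" using * N0 by simp
    show ?thesis by (rule mult_right_le_imp_le[OF m p])
  qed (simp add: sum_nonneg)
  then show ?thesis unfolding B by simp
qed

subsection \<open>Kraus operators\<close>

definition adj :: "complex ^ 'a::finite ^ 'b::finite \<Rightarrow> complex ^ 'b ^ 'a" where
  "adj A = (\<chi> i j. cnj (A $ j $ i))"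

lemma cinner_adj: "cinner u (A *v w) = cinner (adj A *v u) w"
proof -
  have "cinner u (A *v w) = (\<Sum>x\<in>UNIV. \<Sum>i\<in>UNIV. cnj (u $ x) * A $ x $ i * w $ i)"
    by (simp add: cinner_def matrix_vector_mult_def sum_distrib_left algebra_simps)
  also have "\<dots> = (\<Sum>i\<in>UNIV. \<Sum>x\<in>UNIV. cnj (u $ x) * A $ x $ i * w $ i)" by (rule sum.swap)
  also have "\<dots> = cinner (adj A *v u) w"
    by (simp add: cinner_def matrix_vector_mult_def adj_def sum_distrib_left algebra_simps)
  finally show ?thesis .
qed

lemma matrix_mult_sum:
  fixes f :: "'i \<Rightarrow> 'a::comm_ring_1 ^ 'n::finite ^ 'm::finite"
  shows "sum f C ** B = (\<Sum>c\<in>C. f c ** B)"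
  by (auto simp: vec_eq_iff matrix_matrix_mult_def sum_distrib_right intro: sum.swap)

lemma matrix_add_mult_distrib: "(A + B) ** C = A ** C + B ** C"
  for A :: "'a::comm_ring_1 ^ 'n::finite ^ 'm::finite"
  by (simp add: vec_eq_iff matrix_matrix_mult_def distrib_right sum.distrib)

lemma matrix_vector_mult_sum:
  fixes f :: "'i \<Rightarrow> 'a::comm_ring_1 ^ 'n::finite ^ 'm::finite"
  shows "sum f C *v v = (\<Sum>c\<in>C. f c *v v)"
  by (auto simp: vec_eq_iff matrix_vector_mult_def sum_distrib_right intro: sum.swap)

lemma trace_sum: "trace (sum f C) = (\<Sum>c\<in>C. trace (f c))"
  by (auto simp: trace_def intro: sum.swap)

definition kraus_map ::
    "'i set \<Rightarrow> ('i \<Rightarrow> complex ^ 'a::finite ^ 'b::finite) \<Rightarrow> complex ^ 'a ^ 'a \<Rightarrow> complex ^ 'b ^ 'b" where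
  "kraus_map C A X = (\<Sum>c\<in>C. A c ** X ** adj (A c))"

definition kraus_family :: "'i set \<Rightarrow> ('i \<Rightarrow> complex ^ 'a::finite ^ 'b::finite) \<Rightarrow> bool" where
  "kraus_family C A \<longleftrightarrow> (\<Sum>c\<in>C. adj (A c) ** A c) = mat 1"

lemma nonneg_Reals_sum: "(\<And>c. c \<in> C \<Longrightarrow> f c \<in> \<real>\<^sub>\<ge>\<^sub>0) \<Longrightarrow> sum f C \<in> (\<real>\<^sub>\<ge>\<^sub>0 :: complex set)"
  by (induction C rule: infinite_finite_induct) auto

lemma cscale_mult_left: "cscale c A ** B = cscale c (A ** B)"
  by (simp add: cscale_def matrix_matrix_mult_def vec_eq_iff sum_distrib_left algebra_simps)

lemma cscale_mult_right: "B ** cscale c A = cscale c (B ** A)"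
  by (simp add: cscale_def matrix_matrix_mult_def vec_eq_iff sum_distrib_left algebra_simps)

lemma cscale_add: "cscale c (M + N) = cscale c M + cscale c N" "cscale c 0 = 0"
  by (simp_all add: cscale_def matrix_matrix_mult_def vec_eq_iff sum_distrib_left algebra_simps)

lemma cscale_sum: "cscale c (sum f C) = (\<Sum>i\<in>C. cscale c (f i))"
  by (induction C rule: infinite_finite_induct) (auto simp: cscale_add)

text \<open>Each conjugation moves its adjoint onto the test vectors, so a block form of the image
  is a sum of block forms of \<open>X\<close>. Trace preservation is cyclicity together with
  completeness of the family.\<close>

lemma quantum_channel_kraus_map:
  fixes A :: "'i \<Rightarrow> complex ^ 'a::finite ^ 'b::finite"
  assumes "kraus_family C A"
  shows "quantum_channel (kraus_map C A)"
  unfolding quantum_channel_def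
proof (intro conjI allI)
  show "kraus_map C A (X + Y) = kraus_map C A X + kraus_map C A Y" for X Y
    by (simp add: kraus_map_def matrix_add_mult_distrib matrix_add_ldistrib sum.distrib)
  show "kraus_map C A (cscale c X) = cscale c (kraus_map C A X)" for c X
    by (simp add: kraus_map_def cscale_mult_left cscale_mult_right cscale_sum)
  show "trace (kraus_map C A X) = trace X" for X
  proof -
    have "trace (A c ** X ** adj (A c)) = trace ((adj (A c) ** A c) ** X)" for c
      by (subst trace_mul_sym) (simp add: matrix_mul_assoc)
    then have "trace (kraus_map C A X) = trace ((\<Sum>c\<in>C. adj (A c) ** A c) ** X)"
      by (simp add: kraus_map_def trace_sum matrix_mult_sum)
    with assms show ?thesis by (simp add: kraus_family_def)
  qed
  show "completely_positive (kraus_map C A)"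
    unfolding completely_positive_def
  proof (intro allI impI)
    fix k and X :: "nat \<Rightarrow> nat \<Rightarrow> complex ^ 'a ^ 'a" assume X: "block_psd k X"
    show "block_psd k (\<lambda>i j. kraus_map C A (X i j))"
      unfolding block_psd_def
    proof
      fix v :: "nat \<Rightarrow> complex ^ 'b"
      have "(\<Sum>i<k. \<Sum>j<k. cinner (v i) (kraus_map C A (X i j) *v v j))
          = (\<Sum>i<k. \<Sum>j<k. \<Sum>c\<in>C. cinner (adj (A c) *v v i) (X i j *v (adj (A c) *v v j)))"
        by (simp add: kraus_map_def matrix_vector_mult_sum cinner_sum_right cinner_adj
            flip: matrix_vector_mul_assoc)
      also have "\<dots> = (\<Sum>c\<in>C. \<Sum>i<k. \<Sum>j<k. cinner (adj (A c) *v v i) (X i j *v (adj (A c) *v v j)))"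
        by (subst (2) sum.swap, subst sum.swap) (rule refl)
      also have "\<dots> \<in> \<real>\<^sub>\<ge>\<^sub>0" 
      proof (rule nonneg_Reals_sum)
        fix c
        show "(\<Sum>i<k. \<Sum>j<k. cinner (adj (A c) *v v i) (X i j *v (adj (A c) *v v j))) \<in> \<real>\<^sub>\<ge>\<^sub>0"
          by (rule X[unfolded block_psd_def, rule_format])
      qed
      finally show "(\<Sum>i<k. \<Sum>j<k. cinner (v i) (kraus_map C A (X i j) *v v j)) \<in> \<real>\<^sub>\<ge>\<^sub>0" .
    qed
  qed
qed

section \<open>Positive semidefinite matrices and the Choi matrix\<close>

lemma matrix_unit_nth: "matrix_unit i j $ k $ l = (if k = i \<and> l = j then 1 else 0)"
  by (auto simp: matrix_unit_def axis_def)

lemma matrix_mult_matrix_unit: "(A ** matrix_unit i j ** adj B) $ x $ y = A $ x $ i * cnj (B $ y $ j)"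
proof -
  have *: "(A ** matrix_unit i j) $ x $ k = (if k = j then A $ x $ i else 0)" for k
  proof -
    have "(A ** matrix_unit i j) $ x $ k = (\<Sum>l\<in>UNIV. if l = i then (if k = j then A $ x $ i else 0) else 0)"
      unfolding matrix_matrix_mult_def vec_lambda_beta
      by (intro sum.cong refl) (simp add: matrix_unit_nth)
    then show ?thesis by simp
  qed
  show ?thesis
  proof -
    have "(A ** matrix_unit i j ** adj B) $ x $ y
        = (\<Sum>k\<in>UNIV. if k = j then A $ x $ i * cnj (B $ y $ k) else 0)"
      unfolding matrix_matrix_mult_def[of "A ** matrix_unit i j"] adj_def vec_lambda_beta
      using * by (intro sum.cong refl) simp
    then show ?thesis by simp
  qed
qed

lemma kraus_map_matrix_unit:
  "kraus_map C A (matrix_unit i j) $ x $ y = (\<Sum>c\<in>C. A c $ x $ i * cnj (A c $ y $ j))"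
  by (simp add: kraus_map_def matrix_mult_matrix_unit)

definition psd :: "complex ^ 'k::finite ^ 'k \<Rightarrow> bool" where
  "psd M \<longleftrightarrow> (\<forall>v. cinner v (M *v v) \<in> \<real>\<^sub>\<ge>\<^sub>0)"

lemma matrix_vector_axis: "(M *v axis x 1) = (\<chi> i. M $ i $ x)" for M :: "complex ^ 'k::finite ^ 'l::finite"
proof -
  have "(M *v axis x 1) $ i = (\<Sum>j\<in>UNIV. if j = x then M $ i $ j else 0)" for i
    unfolding matrix_vector_mult_def vec_lambda_beta
    by (intro sum.cong refl) (simp add: axis_def)
  then show ?thesis by (simp add: vec_eq_iff)
qed

text \<open>Combinations of two basis vectors isolate single entries of the form; Hermitian symmetry
  and the vanishing of rows are read off from them.\<close>

lemma psd_two_point: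
  assumes "psd M"
  shows "cnj a * a * M $ i $ i + cnj b * b * M $ j $ j + cnj a * b * M $ i $ j + cnj b * a * M $ j $ i \<in> \<real>\<^sub>\<ge>\<^sub>0"
proof -
  have "cinner (a *s axis i 1 + b *s axis j 1) (M *v (a *s axis i 1 + b *s axis j 1)) \<in> \<real>\<^sub>\<ge>\<^sub>0"
    using assms psd_def by blast
  then show ?thesis
    by (simp add: cinner_simps cinner_axis matrix_vector_right_distrib vector_scalar_commute
        matrix_vector_axis algebra_simps)
qed

text \<open>Polarisation: the coefficients 1, 0 and 0, 1 make the diagonal entries real, 1, 1 makes
  the imaginary parts of the off-diagonal entries opposite, and 1, \<i> makes their real parts
  equal.\<close>

lemma psd_hermitian:
  assumes "psd M"
  shows "M $ j $ i = cnj (M $ i $ j)"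
  using psd_two_point[OF assms, of 1 i 0 j] psd_two_point[OF assms, of 0 i 1 j]
    psd_two_point[OF assms, of 1 i 1 j] psd_two_point[OF assms, of 1 i \<i> j]
  by (simp add: complex_nonneg_Reals_iff complex_eq_iff)

lemma psd_diag_zero:
  assumes "psd M" "M $ x $ x = 0"
  shows "M $ x $ j = 0"
proof (rule ccontr)
  assume nz: "M $ x $ j \<noteq> 0"
  \<comment> \<open>Chosen so that the form with coefficients \<open>?a\<close> and 1 takes the
    value -1.\<close>
  define t where "t = (Re (M $ j $ j) + 1) / (2 * (cmod (M $ x $ j))\<^sup>2)"
  let ?a = "of_real (- t) * M $ x $ j"
  have "0 \<le> Re (cnj ?a * ?a * M $ x $ x + cnj 1 * 1 * M $ j $ j + cnj ?a * 1 * M $ x $ j + cnj 1 * ?a * M $ j $ x)"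
    using psd_two_point[OF assms(1), of ?a x 1 j] by (simp add: complex_nonneg_Reals_iff)
  also have "\<dots> = Re (M $ j $ j) - 2 * t * (cmod (M $ x $ j))\<^sup>2"
    unfolding assms(2) psd_hermitian[OF assms(1), of j x] cmod_power2
    by (simp add: algebra_simps power2_eq_square)
  also have "\<dots> = - 1"
  proof -
    have "2 * t * (cmod (M $ x $ j))\<^sup>2 = Re (M $ j $ j) + 1" using nz by (simp add: t_def)
    then show ?thesis by linarith
  qed
  finally show False by simp
qed

text \<open>Cholesky elimination of one index at a time. The induction runs over the support
  \<open>S\<close>: the Schur complement \<open>M'\<close> is again positive and is supported on the
  smaller set.\<close>

lemma psd_gram_on:
  fixes M :: "complex ^ 'k::finite ^ 'k"
  assumes "finite S" "psd M" "\<And>i j. i \<notin> S \<or> j \<notin> S \<Longrightarrow> M $ i $ j = 0"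
  shows "\<exists>g :: 'k \<Rightarrow> complex ^ 'k. \<forall>i j. M $ i $ j = (\<Sum>c\<in>S. g c $ i * cnj (g c $ j))"
  using assms
proof (induction S arbitrary: M rule: finite_induct)
  case (insert x S)
  define m where "m = Re (M $ x $ x)"
  have m: "M $ x $ x = of_real m" "0 \<le> m"
    using psd_two_point[OF insert.prems(1), of 1 x 0 x]
    by (auto simp: m_def complex_nonneg_Reals_iff complex_eq_iff)
  note herm = psd_hermitian[OF insert.prems(1)]
  \<comment> \<open>If the pivot is zero, division by zero makes \<open>M'\<close> equal to
    \<open>M\<close>, and positivity forces row and column \<open>x\<close> to vanish
    already.\<close>
  define M' where "M' = (\<chi> i j. M $ i $ j - M $ i $ x * M $ x $ j / of_real m)"
  have "psd M'"
    unfolding psd_def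
  proof
    fix v
    define z where "z = (M *v v) $ x"
    have zc: "cinner v (\<chi> i. M $ i $ x) = cnj z"
    proof -
      have "cinner v (\<chi> i. M $ i $ x) = cinner v (M *v axis x 1)" by (simp add: matrix_vector_axis)
      also have "\<dots> = cinner (adj M *v v) (axis x 1)" by (rule cinner_adj)
      also have "adj M = M"
        unfolding vec_eq_iff by (intro allI) (simp add: adj_def herm[symmetric])
      finally show ?thesis by (metis z_def cinner_axis cnj_cinner)
    qed
    \<comment> \<open>Completing the square in direction \<open>x\<close>: with this coefficient the
      form of \<open>M\<close> takes the value that the form of \<open>M'\<close> has at
      \<open>v\<close>.\<close>
    let ?d = "- z / of_real m"
    have "M' *v v = M *v v - (z / of_real m) *s (\<chi> i. M $ i $ x)"
      by (simp add: M'_def z_def vec_eq_iff matrix_vector_mult_def sum_subtractf algebra_simps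
          sum_distrib_left sum_divide_distrib)
    then have 1: "cinner v (M' *v v) = cinner v (M *v v) - z * cnj z / of_real m"
      by (simp add: cinner_simps zc)
    have "cinner (v + ?d *s axis x 1) (M *v (v + ?d *s axis x 1))
       = cinner v (M *v v) + ?d * cnj z + cnj ?d * z + cnj ?d * ?d * of_real m"
      by (simp add: cinner_simps cinner_axis matrix_vector_right_distrib vector_scalar_commute
        matrix_vector_axis zc z_def[symmetric] m(1) algebra_simps)
    also have "\<dots> = cinner v (M *v v) - z * cnj z / of_real m"
      by (cases "m = 0") (auto simp: field_simps)
    finally show "cinner v (M' *v v) \<in> \<real>\<^sub>\<ge>\<^sub>0"
      using insert.prems(1) 1 unfolding psd_def by metis
  qed
  moreover have "M' $ i $ j = 0" if "i \<notin> S \<or> j \<notin> S" for i j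
  proof (cases "i = x \<or> j = x")
    case True
    then show ?thesis
    proof (cases "m = 0")
      case True
      then have "M $ x $ l = 0" for l using psd_diag_zero[OF insert.prems(1), of x] m(1) by simp
      moreover from this have "M $ l $ x = 0" for l using herm[of l x] by simp
      ultimately show ?thesis using \<open>i = x \<or> j = x\<close> by (auto simp: M'_def)
    next
      case False
      with \<open>i = x \<or> j = x\<close> show ?thesis by (auto simp: M'_def m(1))
    qed
  next
    case False
    with that have "i \<notin> insert x S \<or> j \<notin> insert x S" by auto
    then show ?thesis using insert.prems(2)[of i j] insert.prems(2)[of i x] insert.prems(2)[of x j]
      by (auto simp: M'_def)
  qed
  ultimately obtain g :: "'k \<Rightarrow> complex ^ 'k"
    where g: "\<And>i j. M' $ i $ j = (\<Sum>c\<in>S. g c $ i * cnj (g c $ j))"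
    using insert.IH by blast
  \<comment> \<open>The pivot column over the root of the pivot; its outer product is exactly the
    term removed in \<open>M'\<close>.\<close>
  define g' where "g' = g(x := (\<chi> i. M $ i $ x / of_real (sqrt m)))"
  have "M $ i $ j = (\<Sum>c\<in>insert x S. g' c $ i * cnj (g' c $ j))" for i j
  proof -
    have "(\<Sum>c\<in>S. g' c $ i * cnj (g' c $ j)) = M' $ i $ j"
      unfolding g using insert.hyps by (intro sum.cong) (auto simp: g'_def)
    moreover have "g' x $ i * cnj (g' x $ j) = M $ i $ x * M $ x $ j / of_real m"
      using m(2) herm[of x j] by (simp add: g'_def flip: of_real_mult)
    ultimately show ?thesis using insert.hyps by (simp add: M'_def)
  qed
  then show ?case by blast
qed (simp add: psd_def)

text \<open>Choi's theorem. Complete positivity with an ancilla of the input dimension makes the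
  Choi matrix \<open>J\<close> positive, and its Gram vectors, reshaped, are Kraus operators.
  Agreement on matrix units suffices because \<open>tensor_map\<close> evaluates channels only
  there.\<close>

lemma quantum_channel_kraus:
  fixes E :: "complex ^ 'a::finite ^ 'a \<Rightarrow> complex ^ 'b::finite ^ 'b"
  assumes "quantum_channel E"
  obtains A :: "'a \<times> 'b \<Rightarrow> complex ^ 'a ^ 'b"
  where "kraus_family UNIV A" "\<And>i j. E (matrix_unit i j) = kraus_map UNIV A (matrix_unit i j)"
proof -
  define J :: "complex ^ ('a \<times> 'b) ^ ('a \<times> 'b)"
    where "J = (\<chi> x y. E (matrix_unit (fst x) (fst y)) $ snd x $ snd y)"
  let ?k = "CARD('a)"
  \<comment> \<open>Labels the input basis by natural numbers, the index type of the ancilla in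
    \<open>block_psd\<close>.\<close>
  obtain h where h: "bij_betw h {..<?k} (UNIV :: 'a set)"
    using ex_bij_betw_nat_finite[of "UNIV :: 'a set"] unfolding atLeast0LessThan by auto
  let ?X = "\<lambda>i j. matrix_unit (h i) (h j)"
  have unit: "cinner u (matrix_unit i j *v w) = cnj (u $ i) * w $ j" for u w :: "complex ^ 'a" and i j
  proof -
    have "matrix_unit i j *v w = w $ j *s axis i 1"
    proof -
      have "(matrix_unit i j *v w) $ k = (\<Sum>l\<in>UNIV. if l = j then (if k = i then w $ j else 0) else 0)" for k
        unfolding matrix_vector_mult_def vec_lambda_beta
        by (intro sum.cong refl) (simp add: matrix_unit_nth)
      then show ?thesis by (simp add: vec_eq_iff axis_def)
    qed
    then show ?thesis
      by (metis cinner_simps(6) cinner_axis cnj_cinner mult.commute)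
  qed
  \<comment> \<open>Up to normalisation this array is the maximally entangled projector: its form is
    the squared modulus of a single sum.\<close>
  have "block_psd ?k ?X"
    unfolding block_psd_def
  proof
    fix v :: "nat \<Rightarrow> complex ^ 'a"
    have "(\<Sum>i<?k. \<Sum>j<?k. cinner (v i) (?X i j *v v j))
      = cnj (\<Sum>i<?k. v i $ h i) * (\<Sum>i<?k. v i $ h i)"
      by (simp add: unit sum_product)
    also have "\<dots> = of_real ((cmod (\<Sum>i<?k. v i $ h i))\<^sup>2)"
      by (simp add: complex_norm_square mult.commute del: of_real_power)
    also have "\<dots> \<in> \<real>\<^sub>\<ge>\<^sub>0" by (simp del: of_real_power)
    finally show "(\<Sum>i<?k. \<Sum>j<?k. cinner (v i) (?X i j *v v j)) \<in> \<real>\<^sub>\<ge>\<^sub>0" .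
  qed
  then have EX: "block_psd ?k (\<lambda>i j. E (?X i j))"
    using assms by (auto simp: quantum_channel_def completely_positive_def)
  have "psd J"
    unfolding psd_def
  proof
    fix v :: "complex ^ ('a \<times> 'b)"
    define u where "u i = (\<chi> x. v $ (i, x))" for i
    have "cinner v (J *v v) = (\<Sum>i\<in>UNIV. \<Sum>x\<in>UNIV. \<Sum>j\<in>UNIV. \<Sum>y\<in>UNIV.
        cnj (v $ (i, x)) * (E (matrix_unit i j) $ x $ y * v $ (j, y)))"
      by (simp add: cinner_def matrix_vector_mult_def sum_UNIV_prod J_def sum_distrib_left)
    also have "\<dots> = (\<Sum>i\<in>UNIV. \<Sum>j\<in>UNIV. \<Sum>x\<in>UNIV. \<Sum>y\<in>UNIV.
        cnj (v $ (i, x)) * (E (matrix_unit i j) $ x $ y * v $ (j, y)))"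
      by (intro sum.cong refl sum.swap)
    also have "\<dots> = (\<Sum>i\<in>UNIV. \<Sum>j\<in>UNIV. cinner (u i) (E (matrix_unit i j) *v u j))"
      by (simp add: cinner_def matrix_vector_mult_def u_def sum_distrib_left)
    also have "\<dots> = (\<Sum>i<?k. \<Sum>j<?k. cinner (u (h i)) (E (?X i j) *v u (h j)))"
      by (simp add: sum.reindex_bij_betw[OF h, symmetric])
    also have "\<dots> \<in> \<real>\<^sub>\<ge>\<^sub>0" using EX unfolding block_psd_def by (rule allE[of _ "\<lambda>i. u (h i)"])
    finally show "cinner v (J *v v) \<in> \<real>\<^sub>\<ge>\<^sub>0" .
  qed
  from psd_gram_on[OF finite_class.finite_UNIV this]
  obtain g :: "'a \<times> 'b \<Rightarrow> complex ^ ('a \<times> 'b)"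
    where g: "\<And>x y. J $ x $ y = (\<Sum>c\<in>UNIV. g c $ x * cnj (g c $ y))" by auto
  define A :: "'a \<times> 'b \<Rightarrow> complex ^ 'a ^ 'b" where "A c = (\<chi> x i. g c $ (i, x))" for c
  have E: "E (matrix_unit i j) = kraus_map UNIV A (matrix_unit i j)" for i j
  proof -
    have "E (matrix_unit i j) $ x $ y = J $ (i, x) $ (j, y)" for x y by (simp add: J_def)
    then show ?thesis
      by (simp add: vec_eq_iff kraus_map_matrix_unit g A_def)
  qed
  \<comment> \<open>Preservation of the trace of \<open>matrix_unit j i\<close> is the entry at
    \<open>i\<close>, \<open>j\<close> of the completeness relation.\<close>
  have "(\<Sum>c\<in>UNIV. adj (A c) ** A c) $ i $ j = mat 1 $ i $ j" for i j
  proof -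
    have "(\<Sum>c\<in>UNIV. adj (A c) ** A c) $ i $ j
        = (\<Sum>c\<in>UNIV. \<Sum>x\<in>UNIV. A c $ x $ j * cnj (A c $ x $ i))"
      by (simp add: matrix_matrix_mult_def adj_def mult.commute)
    also have "\<dots> = trace (kraus_map UNIV A (matrix_unit j i))"
      unfolding trace_def kraus_map_matrix_unit by (rule sum.swap)
    also have "\<dots> = trace (matrix_unit j i :: complex ^ 'a ^ 'a)"
      using assms unfolding E[symmetric] quantum_channel_def by blast
    also have "\<dots> = mat 1 $ i $ j"
    proof (cases "i = j")
      case False
      then have "(if x = j \<and> x = i then 1 else 0 :: complex) = 0" for x by auto
      with False show ?thesis by (simp add: trace_def matrix_unit_nth mat_def)
    qed (simp add: trace_def matrix_unit_nth mat_def)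
    finally show ?thesis .
  qed
  then have "kraus_family UNIV A" unfolding kraus_family_def by (simp add: vec_eq_iff)
  with E that show ?thesis by blast
qed

subsection \<open>Upper bound on the fidelity\<close>

text \<open>Rectangular counterpart of \<open>tensor_mat\<close>: a Kraus operator may change the
  dimension.\<close>

definition tensor_op ::
    "complex ^ 'a::finite ^ 'c::finite \<Rightarrow> complex ^ 'b::finite ^ 'd::finite \<Rightarrow> complex ^ ('a \<times> 'b) ^ ('c \<times> 'd)" where
  "tensor_op A B = (\<chi> p x. A $ fst p $ fst x * B $ snd p $ snd x)"

lemma tensor_op_tensor_vec: "tensor_op A B *v tensor_vec u v = tensor_vec (A *v u) (B *v v)"
  by (simp add: vec_eq_iff matrix_vector_mult_def tensor_op_def tensor_vec_def sum_UNIV_prod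
      sum_product algebra_simps)

lemma cinner_ketbra: "cinner v (ketbra w *v v) = of_real ((cmod (cinner v w))\<^sup>2)"
proof -
  have "ketbra w *v v = cinner w v *s w"
    by (simp add: vec_eq_iff matrix_vector_mult_def ketbra_def cinner_def sum_distrib_left algebra_simps)
  then have "cinner v (ketbra w *v v) = cinner v w * cnj (cinner v w)"
    by (simp add: cinner_simps cnj_cinner)
  then show ?thesis by (simp only: complex_norm_square)
qed

lemma sum_swap_pairs:
  "(\<Sum>x\<in>X. \<Sum>y\<in>Y. \<Sum>c\<in>C. \<Sum>b\<in>D. G x y c b) = (\<Sum>c\<in>C. \<Sum>b\<in>D. \<Sum>x\<in>X. \<Sum>y\<in>Y. G x y c b)"
proof -
  have "(\<Sum>x\<in>X. \<Sum>y\<in>Y. \<Sum>c\<in>C. \<Sum>b\<in>D. G x y c b) = (\<Sum>x\<in>X. \<Sum>c\<in>C. \<Sum>y\<in>Y. \<Sum>b\<in>D. G x y c b)"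
    by (intro sum.cong refl sum.swap)
  also have "\<dots> = (\<Sum>c\<in>C. \<Sum>x\<in>X. \<Sum>y\<in>Y. \<Sum>b\<in>D. G x y c b)" by (rule sum.swap)
  also have "\<dots> = (\<Sum>c\<in>C. \<Sum>x\<in>X. \<Sum>b\<in>D. \<Sum>y\<in>Y. G x y c b)"
    by (intro sum.cong refl sum.swap)
  also have "\<dots> = (\<Sum>c\<in>C. \<Sum>b\<in>D. \<Sum>x\<in>X. \<Sum>y\<in>Y. G x y c b)"
    by (intro sum.cong refl sum.swap)
  finally show ?thesis .
qed

text \<open>A product of two Kraus sums is a sum over pairs, so each pair of local operators
  contributes one pure term.\<close>

lemma tensor_map_kraus:
  assumes E: "\<And>i j. E (matrix_unit i j) = kraus_map C A (matrix_unit i j)"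
    and F: "\<And>i j. F (matrix_unit i j) = kraus_map C' B (matrix_unit i j)"
  shows "tensor_map E F (ketbra \<phi>) = (\<Sum>c\<in>C. \<Sum>b\<in>C'. ketbra (tensor_op (A c) (B b) *v \<phi>))"
proof -
  have "tensor_map E F (ketbra \<phi>) $ p $ q = (\<Sum>c\<in>C. \<Sum>b\<in>C'. ketbra (tensor_op (A c) (B b) *v \<phi>) $ p $ q)"
    for p q
  proof -
    let ?G = "\<lambda>x y c b. (tensor_op (A c) (B b) $ p $ x * \<phi> $ x) * cnj (tensor_op (A c) (B b) $ q $ y * \<phi> $ y)"
    have "tensor_map E F (ketbra \<phi>) $ p $ q = (\<Sum>x\<in>UNIV. \<Sum>y\<in>UNIV. (\<phi> $ x * cnj (\<phi> $ y)) *
       ((\<Sum>c\<in>C. A c $ fst p $ fst x * cnj (A c $ fst q $ fst y))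
        * (\<Sum>b\<in>C'. B b $ snd p $ snd x * cnj (B b $ snd q $ snd y))))"
      by (simp add: tensor_map_def cscale_def tensor_mat_def E F kraus_map_matrix_unit ketbra_def)
    also have "\<dots> = (\<Sum>x\<in>UNIV. \<Sum>y\<in>UNIV. \<Sum>c\<in>C. \<Sum>b\<in>C'. ?G x y c b)"
      unfolding sum_product unfolding sum_distrib_left
      by (intro sum.cong refl) (simp add: tensor_op_def algebra_simps)
    also have "\<dots> = (\<Sum>c\<in>C. \<Sum>b\<in>C'. \<Sum>x\<in>UNIV. \<Sum>y\<in>UNIV. ?G x y c b)" by (rule sum_swap_pairs)
    also have "\<dots> = (\<Sum>c\<in>C. \<Sum>b\<in>C'. ketbra (tensor_op (A c) (B b) *v \<phi>) $ p $ q)"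
      by (simp add: ketbra_def matrix_vector_mult_def sum_product)
    finally show ?thesis .
  qed
  then show ?thesis by (simp add: vec_eq_iff)
qed

lemma fidelity_kraus:
  assumes "\<And>i j. E (matrix_unit i j) = kraus_map C A (matrix_unit i j)"
    and "\<And>i j. F (matrix_unit i j) = kraus_map C' B (matrix_unit i j)"
  shows "Re (cinner \<psi> (tensor_map E F (ketbra \<phi>) *v \<psi>))
    = (\<Sum>c\<in>C. \<Sum>b\<in>C'. (cmod (cinner \<psi> (tensor_op (A c) (B b) *v \<phi>)))\<^sup>2)"
  unfolding tensor_map_kraus[OF assms]
  by (simp add: matrix_vector_mult_sum cinner_sum_right cinner_ketbra del: of_real_power)

lemma matrix_vector_mult_sum_right: "A *v sum f S = (\<Sum>i\<in>S. A *v f i)"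
  for A :: "complex ^ 'n::finite ^ 'm::finite"
  by (induction S rule: infinite_finite_induct) (auto simp: matrix_vector_right_distrib)

lemma matrix_vector_mult_scaleR_right: "A *v (r *\<^sub>R x) = r *\<^sub>R (A *v x)"
  for A :: "complex ^ 'n::finite ^ 'm::finite"
  by (simp add: vec_eq_iff matrix_vector_mult_def scaleR_sum_right)

lemma cinner_max_entangled:
  "cinner (max_entangled :: complex ^ ('d::finite \<times> 'd)) w
    = of_real (1 / sqrt (real CARD('d))) * (\<Sum>t\<in>UNIV. w $ (t, t))"
  by (simp add: max_entangled_def cinner_simps cinner_sum_left cinner_tensor_axis)

text \<open>Pairing with the maximally entangled state is bilinear in the two local images, with no
  conjugate on either: only equal target indices meet.\<close>

lemma max_entangled_overlap:
  fixes A :: "complex ^ 'a::finite ^ 'd::finite" and B :: "complex ^ 'b::finite ^ 'd"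
  shows "cinner max_entangled (tensor_op A B *v (\<Sum>s\<in>UNIV. w s *\<^sub>R tensor_vec (U s) (V s)))
    = of_real (1 / sqrt (real CARD('d))) * (\<Sum>s\<in>UNIV. of_real (w s) * (\<Sum>t\<in>UNIV. (A *v U s) $ t * (B *v V s) $ t))"
  unfolding matrix_vector_mult_sum_right cinner_sum_right matrix_vector_mult_scaleR_right
    tensor_op_tensor_vec cinner_simps cinner_max_entangled
  by (simp add: tensor_vec_def sum_distrib_left algebra_simps)

text \<open>Stacked, the Kraus operators form an isometry into environment tensor target, because
  the sum of their \<open>adj (A c) ** A c\<close> is the identity.\<close>

lemma kraus_family_cinner:
  assumes "kraus_family C A"
  shows "(\<Sum>c\<in>C. cinner (A c *v u) (A c *v w)) = cinner u w"
proof -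
  have "(\<Sum>c\<in>C. cinner (A c *v u) (A c *v w)) = (\<Sum>c\<in>C. cinner (adj (A c) *v (A c *v u)) w)"
    by (simp add: cinner_adj)
  also have "\<dots> = cinner ((\<Sum>c\<in>C. adj (A c) ** A c) *v u) w"
    by (simp add: matrix_vector_mult_sum cinner_sum_left matrix_vector_mul_assoc)
  finally show ?thesis using assms by (simp add: kraus_family_def)
qed

section \<open>Row and column bounds for the overlap weights\<close>

lemma partial_right_axis: "partial_right (axis t 1) v $ a = v $ (a, t)"
proof -
  have "partial_right (axis t 1) v $ a = (\<Sum>b\<in>UNIV. if b = t then v $ (a, b) else 0)"
    unfolding partial_right_def vec_lambda_beta by (intro sum.cong refl) (simp add: axis_def)
  then show ?thesis by simp
qed

lemma norm_squared_partial_right: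
  "(\<Sum>t\<in>UNIV. (norm (partial_right (axis t 1) v))\<^sup>2) = (norm v)\<^sup>2"
  unfolding norm_squared_vec partial_right_axis sum_UNIV_prod by (rule sum.swap)

text \<open>Bessel's inequality for \<open>e\<close> is applied to each target slice of
  \<open>v\<close>; the squared norms of the slices add up to that of \<open>v\<close>.\<close>

lemma partial_row_le:
  assumes "orthonormal_on {..<l::nat} e" "norm v = 1"
  shows "(\<Sum>k<l. \<Sum>t\<in>UNIV. (cmod (cinner (e k) (partial_right (axis t 1) v)))\<^sup>2) \<le> 1"
proof -
  have "(\<Sum>k<l. \<Sum>t\<in>UNIV. (cmod (cinner (e k) (partial_right (axis t 1) v)))\<^sup>2)
    = (\<Sum>t\<in>UNIV. \<Sum>k<l. (cmod (cinner (e k) (partial_right (axis t 1) v)))\<^sup>2)" by (rule sum.swap)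
  also have "\<dots> \<le> (\<Sum>t\<in>UNIV. (norm (partial_right (axis t 1) v))\<^sup>2)"
    by (intro sum_mono Bessel_inequality assms) simp
  finally show ?thesis using assms(2) by (simp add: norm_squared_partial_right)
qed

text \<open>The roles are exchanged: the orthonormal family is now \<open>Y\<close>, tested on
  \<open>e\<close> tensor each target basis vector, and each of these contributes at most 1.\<close>

lemma partial_col_le:
  fixes Y :: "'s::finite \<Rightarrow> complex ^ ('c::finite \<times> 't::finite)"
  assumes "orthonormal_family Y" "norm e = 1"
  shows "(\<Sum>s\<in>UNIV. \<Sum>t\<in>UNIV. (cmod (cinner e (partial_right (axis t 1) (Y s))))\<^sup>2) \<le> real CARD('t)"
proof -
  have "(\<Sum>s\<in>UNIV. \<Sum>t\<in>UNIV. (cmod (cinner e (partial_right (axis t 1) (Y s))))\<^sup>2)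
    = (\<Sum>t\<in>UNIV. \<Sum>s\<in>UNIV. (cmod (cinner (Y s) (tensor_vec e (axis t 1))))\<^sup>2)"
    by (subst sum.swap) (simp add: cinner_tensor_partial_right[symmetric] cmod_cinner_commute)
  also have "\<dots> \<le> (\<Sum>t\<in>(UNIV :: 't set). (norm (tensor_vec e (axis t 1 :: complex ^ 't)))\<^sup>2)"
    using assms(1) by (intro sum_mono Bessel_inequality) (auto simp: orthonormal_family_iff_on)
  also have "\<dots> = real CARD('t)" using assms(2) by (simp add: norm_tensor_vec)
  finally show ?thesis .
qed

lemma overlap_matrix_bound:
  fixes Y :: "'s::finite \<Rightarrow> complex ^ ('c::finite \<times> 't::finite)"
    and Z :: "'s \<Rightarrow> complex ^ ('e::finite \<times> 't)"
  assumes Y: "orthonormal_family Y" and Z: "orthonormal_family Z"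
    and b: "bij_betw b {..<CARD('s)} UNIV"
      "\<And>i j. i \<le> j \<Longrightarrow> j < CARD('s) \<Longrightarrow> w (b j) \<le> w (b i)"
    and w: "\<And>s. 0 \<le> w s"
  shows "(\<Sum>a\<in>UNIV. \<Sum>c\<in>UNIV. (cmod (\<Sum>s\<in>UNIV. of_real (w s) * (\<Sum>t\<in>UNIV. Y s $ (a, t) * Z s $ (c, t))))\<^sup>2)
    \<le> (\<Sum>i<CARD('s). (block_sum CARD('t) (w \<circ> b) CARD('s) i)\<^sup>2)"
proof -
  \<comment> \<open>The matrix of overlaps as a bipartite vector over the two environments. Slicing
    along the target index writes it in product vectors, so pairing with singular vectors goes term
    by term.\<close>
  define M where "M = (\<Sum>s\<in>UNIV. w s *\<^sub>R (\<Sum>t\<in>UNIV.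
    tensor_vec (partial_right (axis t 1) (Y s)) (partial_right (axis t 1) (Z s))))"
  have M: "M $ (a, c) = (\<Sum>s\<in>UNIV. of_real (w s) * (\<Sum>t\<in>UNIV. Y s $ (a, t) * Z s $ (c, t)))" for a c
    by (simp add: M_def tensor_vec_def partial_right_axis scaleR_conv_of_real[where 'a = complex])
  obtain l :: nat and e f \<sigma> where "orthonormal_on {..<l} e \<and> orthonormal_on {..<l} f \<and>
      (\<forall>i<l. 0 \<le> \<sigma> i) \<and> M = (\<Sum>i<l. \<sigma> i *\<^sub>R tensor_vec (e i) (f i))"
    using schmidt_decomposition_exists[of M] by (elim exE)
  then have e: "orthonormal_on {..<l} e" and f: "orthonormal_on {..<l} f"
    and \<sigma>: "\<And>i. i < l \<Longrightarrow> 0 \<le> \<sigma> i" and Ms: "M = (\<Sum>i<l. \<sigma> i *\<^sub>R tensor_vec (e i) (f i))"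
    by simp_all
  have \<sigma>k: "cinner (tensor_vec (e k) (f k)) M = of_real (\<sigma> k)" if "k < l" for k
  proof -
    have "cinner (tensor_vec (e k) (f k)) M = (\<Sum>i<l. if i = k then of_real (\<sigma> k) else 0)"
      unfolding Ms cinner_sum_right
      by (intro sum.cong refl) (use that e f in \<open>auto simp: cinner_simps cinner_tensor_vec orthonormal_on_def\<close>)
    then show ?thesis using that by simp
  qed
  have normM: "(norm M)\<^sup>2 = (\<Sum>k<l. (\<sigma> k)\<^sup>2)"
  proof -
    have "complex_of_real ((norm M)\<^sup>2) = (\<Sum>k<l. cinner (\<sigma> k *\<^sub>R tensor_vec (e k) (f k)) M)"
      unfolding cinner_self[symmetric] by (subst (1) Ms) (rule cinner_sum_left)
    also have "\<dots> = of_real (\<Sum>k<l. (\<sigma> k)\<^sup>2)"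
      unfolding of_real_sum
      by (intro sum.cong refl) (simp add: cinner_simps \<sigma>k power2_eq_square)
    finally show ?thesis using of_real_eq_iff by blast
  qed
  define y where "y s k t = cmod (cinner (e k) (partial_right (axis t 1) (Y s)))" for s k t
  define z where "z s k t = cmod (cinner (f k) (partial_right (axis t 1) (Z s)))" for s k t
  \<comment> \<open>Half the sum of squares dominates \<open>y s k t * z s k t\<close>, and the
    average of the two parties inherits the row and column bounds that each obeys.\<close>
  define W where "W s k = (\<Sum>t\<in>UNIV. ((y s k t)\<^sup>2 + (z s k t)\<^sup>2) / 2)" for s k
  have W_eq: "W s k = ((\<Sum>t\<in>UNIV. (y s k t)\<^sup>2) + (\<Sum>t\<in>UNIV. (z s k t)\<^sup>2)) / 2" for s k
    by (simp add: W_def sum.distrib flip: sum_divide_distrib)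
  have nY: "norm (Y s) = 1" "norm (Z s) = 1" for s
    using orthonormal_on_norm[of UNIV Y s] orthonormal_on_norm[of UNIV Z s] Y Z
    by (auto simp: orthonormal_family_iff_on)
  have "(\<Sum>a\<in>UNIV. \<Sum>c\<in>UNIV. (cmod (M $ (a, c)))\<^sup>2) = (\<Sum>k<l. (\<sigma> k)\<^sup>2)"
    using normM unfolding norm_squared_vec sum_UNIV_prod .
  also have "\<dots> \<le> (\<Sum>i<CARD('s). (block_sum CARD('t) (w \<circ> b) CARD('s) i)\<^sup>2)"
  proof (rule square_sum_bound[where W = W and q = w and b = b, OF b w _ \<sigma>])
    show "0 \<le> W s k" for s k by (simp add: W_def sum_nonneg)
    show "(\<Sum>k<l. W s k) \<le> 1" for s
      using partial_row_le[OF e nY(1)[of s]] partial_row_le[OF f nY(2)[of s]]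
      by (simp add: W_eq y_def z_def sum.distrib flip: sum_divide_distrib)
    show "(\<Sum>s\<in>UNIV. W s k) \<le> real CARD('t)" if "k < l" for k
    proof -
      have "norm (e k) = 1" "norm (f k) = 1" using that orthonormal_on_norm[OF e] orthonormal_on_norm[OF f] by auto
      from partial_col_le[OF Y this(1)] partial_col_le[OF Z this(2)] show ?thesis
        by (simp add: W_eq y_def z_def sum.distrib flip: sum_divide_distrib)
    qed
    show "\<sigma> k \<le> (\<Sum>s\<in>UNIV. w s * W s k)" if "k < l" for k
    proof -
      have "\<sigma> k = cmod (cinner (tensor_vec (e k) (f k)) M)" using \<sigma>k[OF that] \<sigma>[OF that] by simp
      also have "\<dots> = cmod (\<Sum>s\<in>UNIV. of_real (w s) * (\<Sum>t\<in>UNIV.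
          cinner (e k) (partial_right (axis t 1) (Y s)) * cinner (f k) (partial_right (axis t 1) (Z s))))"
        by (simp add: M_def cinner_sum_right cinner_simps cinner_tensor_vec)
      also have "\<dots> \<le> (\<Sum>s\<in>UNIV. cmod (of_real (w s) * (\<Sum>t\<in>UNIV.
          cinner (e k) (partial_right (axis t 1) (Y s)) * cinner (f k) (partial_right (axis t 1) (Z s)))))"
        by (rule norm_sum)
      also have "\<dots> \<le> (\<Sum>s\<in>UNIV. w s * W s k)"
      proof (rule sum_mono)
        fix s
        have "cmod (\<Sum>t\<in>UNIV. cinner (e k) (partial_right (axis t 1) (Y s)) * cinner (f k) (partial_right (axis t 1) (Z s)))
          \<le> (\<Sum>t\<in>UNIV. y s k t * z s k t)"
          unfolding y_def z_def norm_mult[symmetric] by (rule norm_sum)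
        also have "\<dots> \<le> W s k"
          unfolding W_def
        proof (rule sum_mono)
          fix t
          show "y s k t * z s k t \<le> ((y s k t)\<^sup>2 + (z s k t)\<^sup>2) / 2"
            using sum_squares_bound[of "y s k t" "z s k t"] by simp
        qed
        finally show "cmod (of_real (w s) * (\<Sum>t\<in>UNIV.
          cinner (e k) (partial_right (axis t 1) (Y s)) * cinner (f k) (partial_right (axis t 1) (Z s))))
          \<le> w s * W s k"
          using w[of s] by (simp add: norm_mult mult_left_mono)
      qed
      finally show ?thesis .
    qed
  qed simp_all
  finally show ?thesis unfolding M .
qed

lemma fidelity_upper_bound:
  fixes U :: "'s::finite \<Rightarrow> complex ^ 'a::finite" and V :: "'s \<Rightarrow> complex ^ 'b::finite"
    and E :: "complex ^ 'a ^ 'a \<Rightarrow> complex ^ 'd::finite ^ 'd"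
    and F :: "complex ^ 'b ^ 'b \<Rightarrow> complex ^ 'd ^ 'd"
  assumes E: "quantum_channel E" and F: "quantum_channel F"
    and U: "orthonormal_family U" and V: "orthonormal_family V"
    and b: "bij_betw b {..<CARD('s)} UNIV"
      "\<And>i j. i \<le> j \<Longrightarrow> j < CARD('s) \<Longrightarrow> w (b j) \<le> w (b i)"
    and w: "\<And>s. 0 \<le> w s"
    and \<phi>: "\<phi> = (\<Sum>s\<in>UNIV. w s *\<^sub>R tensor_vec (U s) (V s))"
  shows "Re (cinner max_entangled (tensor_map E F (ketbra \<phi>) *v max_entangled))
    \<le> 1 / real CARD('d) * (\<Sum>i<CARD('s). (block_sum CARD('d) (w \<circ> b) CARD('s) i)\<^sup>2)"
proof -
  obtain A :: "'a \<times> 'd \<Rightarrow> complex ^ 'a ^ 'd"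
    where A: "kraus_family UNIV A" "\<And>i j. E (matrix_unit i j) = kraus_map UNIV A (matrix_unit i j)"
    using quantum_channel_kraus[OF E] by blast
  obtain B :: "'b \<times> 'd \<Rightarrow> complex ^ 'b ^ 'd"
    where B: "kraus_family UNIV B" "\<And>i j. F (matrix_unit i j) = kraus_map UNIV B (matrix_unit i j)"
    using quantum_channel_kraus[OF F] by blast
  \<comment> \<open>The Kraus index becomes the first tensor factor, the environment;
    \<open>kraus_family_cinner\<close> makes both families orthonormal.\<close>
  define Y where "Y s = (\<chi> x. (A (fst x) *v U s) $ snd x)" for s
  define Z where "Z s = (\<chi> x. (B (fst x) *v V s) $ snd x)" for s
  have "cinner (Y s) (Y s') = cinner (U s) (U s')" for s s'
    unfolding kraus_family_cinner[OF A(1), symmetric]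
    by (simp add: cinner_def Y_def sum_UNIV_prod)
  then have Y: "orthonormal_family Y" using U by (simp add: orthonormal_family_def)
  have "cinner (Z s) (Z s') = cinner (V s) (V s')" for s s'
    unfolding kraus_family_cinner[OF B(1), symmetric]
    by (simp add: cinner_def Z_def sum_UNIV_prod)
  then have Z: "orthonormal_family Z" using V by (simp add: orthonormal_family_def)
  have "Re (cinner max_entangled (tensor_map E F (ketbra \<phi>) *v max_entangled))
    = (\<Sum>a\<in>UNIV. \<Sum>c\<in>UNIV. 1 / real CARD('d) *
        (cmod (\<Sum>s\<in>UNIV. of_real (w s) * (\<Sum>t\<in>UNIV. Y s $ (a, t) * Z s $ (c, t))))\<^sup>2)"
    unfolding fidelity_kraus[OF A(2) B(2)] \<phi> max_entangled_overlap
    by (simp add: Y_def Z_def norm_mult power_mult_distrib norm_divide power_divide)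
  also have "\<dots> = 1 / real CARD('d) * (\<Sum>a\<in>UNIV. \<Sum>c\<in>UNIV.
        (cmod (\<Sum>s\<in>UNIV. of_real (w s) * (\<Sum>t\<in>UNIV. Y s $ (a, t) * Z s $ (c, t))))\<^sup>2)"
    by (simp add: sum_distrib_left)
  also have "\<dots> \<le> 1 / real CARD('d) * (\<Sum>i<CARD('s). (block_sum CARD('d) (w \<circ> b) CARD('s) i)\<^sup>2)"
    by (intro mult_left_mono overlap_matrix_bound[where w = w and b = b, OF Y Z b w]) simp_all
  finally show ?thesis .
qed

subsection \<open>A pair of channels attaining the bound\<close>

text \<open>The \<open>Inr\<close> operators only make the family trace preserving outside the span of \<open>U\<close>;
  \<open>undefined\<close> is an arbitrary basis index.\<close>

definition block_kraus ::
    "('s::finite \<Rightarrow> complex ^ 'a::finite) \<Rightarrow> ('s \<Rightarrow> nat) \<Rightarrow> ('s \<Rightarrow> 'd::finite) \<Rightarrow> nat + 'a \<Rightarrow> complex ^ 'a ^ 'd"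
  where
  "block_kraus U h pos c = (\<chi> t x. case c of
      Inl i \<Rightarrow> (\<Sum>s\<in>UNIV. if h s = i \<and> pos s = t then cnj (U s $ x) else 0)
    | Inr y \<Rightarrow> if t = undefined then (mat 1 - (\<Sum>s\<in>UNIV. ketbra (U s))) $ y $ x else 0)"

lemma ketbra_mult: "ketbra u ** ketbra v = cscale (cinner u v) (\<chi> i j. u $ i * cnj (v $ j))"
  by (simp add: vec_eq_iff matrix_matrix_mult_def ketbra_def cscale_def cinner_def sum_distrib_left
      sum_distrib_right algebra_simps)

lemma ketbra_sum_idem:
  fixes U :: "'s::finite \<Rightarrow> complex ^ 'a::finite"
  assumes "orthonormal_family U"
  shows "(\<Sum>s\<in>UNIV. ketbra (U s)) ** (\<Sum>s\<in>UNIV. ketbra (U s)) = (\<Sum>s\<in>UNIV. ketbra (U s))"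
proof -
  have r: "B ** sum f C = (\<Sum>c\<in>C. B ** f c)" for B :: "complex ^ 'a ^ 'a" and f :: "'s \<Rightarrow> _" and C
    by (auto simp: vec_eq_iff matrix_matrix_mult_def sum_distrib_left intro: sum.swap)
  have "ketbra (U s) ** ketbra (U s') = (if s' = s then ketbra (U s) else 0)" for s s'
    using assms unfolding ketbra_mult orthonormal_family_def
    by (auto simp: cscale_def ketbra_def vec_eq_iff)
  then show ?thesis by (simp add: matrix_mult_sum r)
qed

lemma matrix_diff_mult_left: "(A - B) ** C = A ** C - B ** C"
  for A :: "complex ^ 'n::finite ^ 'm::finite"
  by (simp add: vec_eq_iff matrix_matrix_mult_def left_diff_distrib sum_subtractf)

lemma matrix_diff_mult_right: "C ** (A - B) = C ** A - C ** B"
  for C :: "complex ^ 'n::finite ^ 'm::finite"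
  by (simp add: vec_eq_iff matrix_matrix_mult_def right_diff_distrib sum_subtractf)

text \<open>At most one index satisfies \<open>P\<close>, so there are no cross terms. For
  \<open>block_kraus\<close>, \<open>P\<close> fixes a block and a position in it.\<close>

lemma sum_unique_product:
  fixes a b :: "'s::finite \<Rightarrow> complex"
  assumes "\<And>s s'. P s \<Longrightarrow> P s' \<Longrightarrow> s = s'"
  shows "(\<Sum>s\<in>UNIV. if P s then a s else 0) * (\<Sum>s\<in>UNIV. if P s then b s else 0)
    = (\<Sum>s\<in>UNIV. if P s then a s * b s else 0)"
proof (cases "\<exists>s. P s")
  case True
  then obtain s0 where "P s0" by blast
  then have "P s \<longleftrightarrow> s = s0" for s using assms by blast
  then show ?thesis by simp
qed simp

text \<open>The \<open>Inl\<close> operators resolve the projection \<open>K\<close> onto the span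
  of \<open>U\<close>, one Schmidt vector for each occupied block and position. The
  \<open>Inr\<close> operators are the rows of the complement \<open>Q\<close> and contribute
  \<open>adj Q ** Q\<close>, which is \<open>Q\<close>.\<close>

lemma block_kraus_family:
  fixes U :: "'s::finite \<Rightarrow> complex ^ 'a::finite" and pos :: "'s \<Rightarrow> 'd::finite"
  assumes U: "orthonormal_family U" and h: "\<And>s. h s < T"
    and inj: "\<And>s s'. h s = h s' \<Longrightarrow> pos s = pos s' \<Longrightarrow> s = s'"
  shows "kraus_family ({..<T} <+> UNIV) (block_kraus U h pos)"
proof -
  define K where "K = (\<Sum>s\<in>UNIV. ketbra (U s))"
  define Q where "Q = mat 1 - K"
  have K: "K $ p $ q = (\<Sum>s\<in>UNIV. U s $ p * cnj (U s $ q))" for p q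
    by (simp add: K_def ketbra_def)
  have K2: "K ** K = K" unfolding K_def by (rule ketbra_sum_idem[OF U])
  have adjK: "adj K = K" by (simp add: adj_def vec_eq_iff K mult.commute)
  have adjQ: "adj Q = Q"
    using adjK by (auto simp: Q_def adj_def vec_eq_iff mat_def)
  have Q2: "Q ** Q = Q"
  proof -
    have "(K ** K) $ p $ q = K $ p $ q" for p q by (simp add: K2)
    moreover have "(Q ** Q) $ p $ q = mat 1 $ p $ q - K $ p $ q - K $ p $ q + (K ** K) $ p $ q" for p q
    proof -
      have "Q ** Q = (mat 1 - K) ** mat 1 - (mat 1 - K) ** K"
        by (simp only: Q_def matrix_diff_mult_right)
      moreover have "(mat 1 - K) ** K = mat 1 ** K - K ** K"
        by (rule matrix_diff_mult_left)
      ultimately show ?thesis by simp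
    qed
    ultimately show ?thesis by (simp add: vec_eq_iff Q_def)
  qed
  have Inr: "(\<Sum>y\<in>UNIV. adj (block_kraus U h pos (Inr y)) ** block_kraus U h pos (Inr y)) = Q"
  proof -
    have "(adj (block_kraus U h pos (Inr y)) ** block_kraus U h pos (Inr y)) $ p $ q
        = (\<Sum>t\<in>UNIV. if t = (undefined :: 'd) then cnj (Q $ y $ p) * Q $ y $ q else 0)" for y p q
      unfolding matrix_matrix_mult_def vec_lambda_beta
      by (intro sum.cong refl) (simp add: adj_def block_kraus_def Q_def K_def)
    moreover have "(adj Q ** Q) $ p $ q = (\<Sum>y\<in>UNIV. cnj (Q $ y $ p) * Q $ y $ q)" for p q
      by (simp add: matrix_matrix_mult_def adj_def)
    ultimately have "(\<Sum>y\<in>UNIV. adj (block_kraus U h pos (Inr y)) ** block_kraus U h pos (Inr y)) $ p $ q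
        = (adj Q ** Q) $ p $ q" for p q by simp
    then show ?thesis by (simp add: vec_eq_iff adjQ Q2)
  qed
  have Inl: "(\<Sum>i<T. adj (block_kraus U h pos (Inl i)) ** block_kraus U h pos (Inl i)) = K"
  proof -
    have "(adj (block_kraus U h pos (Inl i)) ** block_kraus U h pos (Inl i)) $ p $ q
        = (\<Sum>t\<in>UNIV. \<Sum>s\<in>UNIV. if h s = i \<and> pos s = t then U s $ p * cnj (U s $ q) else 0)" for i p q
    proof -
      have "(adj (block_kraus U h pos (Inl i)) ** block_kraus U h pos (Inl i)) $ p $ q
        = (\<Sum>t\<in>UNIV. (\<Sum>s\<in>UNIV. if h s = i \<and> pos s = t then U s $ p else 0) *
            (\<Sum>s\<in>UNIV. if h s = i \<and> pos s = t then cnj (U s $ q) else 0))"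
        unfolding matrix_matrix_mult_def vec_lambda_beta
        by (intro sum.cong refl) (simp add: adj_def block_kraus_def if_distrib[of cnj] cong: if_cong)
      also have "\<dots> = (\<Sum>t\<in>UNIV. \<Sum>s\<in>UNIV. if h s = i \<and> pos s = t then U s $ p * cnj (U s $ q) else 0)"
        by (intro sum.cong refl sum_unique_product) (use inj in auto)
      finally show ?thesis .
    qed
    then have "(\<Sum>i<T. adj (block_kraus U h pos (Inl i)) ** block_kraus U h pos (Inl i)) $ p $ q
        = (\<Sum>i<T. \<Sum>s\<in>UNIV. \<Sum>t\<in>UNIV. if h s = i \<and> pos s = t then U s $ p * cnj (U s $ q) else 0)" for p q
      by (simp, intro sum.cong refl) (rule sum.swap)
    also have "(\<Sum>i<T. \<Sum>s\<in>UNIV. \<Sum>t\<in>UNIV. if h s = i \<and> pos s = t then U s $ p * cnj (U s $ q) else 0)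
        = (\<Sum>s\<in>UNIV. \<Sum>i<T. if i = h s then U s $ p * cnj (U s $ q) else 0)" for p q
      by (subst sum.swap) (intro sum.cong refl, auto)
    also have "(\<Sum>s\<in>UNIV. \<Sum>i<T. if i = h s then U s $ p * cnj (U s $ q) else 0) = K $ p $ q" for p q
      unfolding K using h by (intro sum.cong refl) simp
    finally show ?thesis by (simp add: vec_eq_iff)
  qed
  have "(\<Sum>c\<in>{..<T} <+> UNIV. adj (block_kraus U h pos c) ** block_kraus U h pos c) = K + Q"
    by (subst sum.Plus) (simp_all add: Inl Inr)
  then show ?thesis by (simp add: kraus_family_def Q_def)
qed

lemma block_kraus_apply:
  fixes U :: "'s::finite \<Rightarrow> complex ^ 'a::finite" and pos :: "'s \<Rightarrow> 'd::finite"
  assumes U: "orthonormal_family U"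
  shows "(block_kraus U h pos (Inl i) *v U s) $ t = (if h s = i \<and> pos s = t then 1 else 0)"
proof -
  have "(block_kraus U h pos (Inl i) *v U s) $ t
      = (\<Sum>x\<in>UNIV. \<Sum>s'\<in>UNIV. if h s' = i \<and> pos s' = t then cnj (U s' $ x) * U s $ x else 0)"
    unfolding matrix_vector_mult_def vec_lambda_beta block_kraus_def
    by (intro sum.cong refl) (simp add: sum_distrib_right if_distrib[of "\<lambda>z. z * _"] cong: if_cong)
  also have "\<dots> = (\<Sum>s'\<in>UNIV. if h s' = i \<and> pos s' = t then cinner (U s') (U s) else 0)"
  proof (subst sum.swap, intro sum.cong refl)
    fix s'
    show "(\<Sum>x\<in>UNIV. if h s' = i \<and> pos s' = t then cnj (U s' $ x) * U s $ x else 0)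
      = (if h s' = i \<and> pos s' = t then cinner (U s') (U s) else 0)"
    proof (cases "h s' = i \<and> pos s' = t")
      case False
      show ?thesis unfolding if_not_P[OF False] by simp
    qed (simp add: cinner_def)
  qed
  also have "\<dots> = (\<Sum>s'\<in>UNIV. if s' = s then if h s = i \<and> pos s = t then 1 else 0 else 0)"
    using U by (intro sum.cong refl) (auto simp: orthonormal_family_def)
  finally show ?thesis by simp
qed

text \<open>When both block indices agree, all Schmidt vectors of the block interfere constructively
  and their coefficients add up before squaring. The remaining terms of the fidelity are squares and
  are dropped, which leaves a lower bound.\<close>

lemma fidelity_attained:
  fixes U :: "'s::finite \<Rightarrow> complex ^ 'a::finite" and V :: "'s \<Rightarrow> complex ^ 'b::finite"
  assumes U: "orthonormal_family U" and V: "orthonormal_family V"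
    and b: "bij_betw b {..<CARD('s)} UNIV"
    and \<phi>: "\<phi> = (\<Sum>s\<in>UNIV. w s *\<^sub>R tensor_vec (U s) (V s))"
  obtains E :: "complex ^ 'a ^ 'a \<Rightarrow> complex ^ 'd::finite ^ 'd"
    and F :: "complex ^ 'b ^ 'b \<Rightarrow> complex ^ 'd ^ 'd"
  where "quantum_channel E" "quantum_channel F"
    "1 / real CARD('d) * (\<Sum>i<CARD('s). (block_sum CARD('d) (w \<circ> b) CARD('s) i)\<^sup>2)
      \<le> Re (cinner max_entangled (tensor_map E F (ketbra \<phi>) *v max_entangled))"
proof -
  let ?T = "CARD('s)" and ?D = "CARD('d)"
  obtain g where g: "bij_betw g {..<?D} (UNIV :: 'd set)"
    using ex_bij_betw_nat_finite[of "UNIV :: 'd set"] unfolding atLeast0LessThan by auto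
  \<comment> \<open>\<open>idx\<close> inverts the enumeration \<open>b\<close>; quotient and
    remainder by \<open>?D\<close> then give the block of a Schmidt vector and its position in the
    block.\<close>
  define idx where "idx = the_inv_into {..<?T} b"
  have idx: "idx s < ?T" "b (idx s) = s" for s
    using b the_inv_into_into[of b "{..<?T}" s "{..<?T}"] f_the_inv_into_f[of b "{..<?T}" s]
    by (auto simp: idx_def bij_betw_def)
  have idx_b: "idx (b j) = j" if "j < ?T" for j
    using b that by (simp add: idx_def bij_betw_def the_inv_into_f_f)
  define h where "h s = idx s div ?D" for s
  define pos where "pos s = g (idx s mod ?D)" for s
  have D: "?D > 0" by simp
  have h: "h s < ?T" for s
    using le_less_trans[OF div_le_dividend idx(1)] by (simp add: h_def)
  have inj: "s = s'" if "h s = h s'" "pos s = pos s'" for s s'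
  proof -
    have "idx s mod ?D = idx s' mod ?D"
      using g that(2) mod_less_divisor[OF D] by (auto simp: pos_def bij_betw_def inj_on_def)
    with that(1) have "idx s = idx s'" unfolding h_def by (metis div_mult_mod_eq)
    then show ?thesis by (metis idx(2))
  qed
  let ?A = "block_kraus U h pos" and ?B = "block_kraus V h pos"
  let ?E = "kraus_map ({..<?T} <+> UNIV) ?A" and ?F = "kraus_map ({..<?T} <+> UNIV) ?B"
  let ?f = "\<lambda>a c. (cmod (cinner max_entangled (tensor_op (?A a) (?B c) *v \<phi>)))\<^sup>2"
  have diag: "?f (Inl i) (Inl i) = 1 / real ?D * (block_sum ?D (w \<circ> b) ?T i)\<^sup>2" for i
  proof -
    have *: "(\<Sum>t\<in>UNIV. (?A (Inl i) *v U s) $ t * (?B (Inl i) *v V s) $ t) = (if h s = i then 1 else 0)" for s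
    proof -
      have "(\<Sum>t\<in>UNIV. (?A (Inl i) *v U s) $ t * (?B (Inl i) *v V s) $ t)
        = (\<Sum>t\<in>UNIV. if t = pos s then if h s = i then 1 else 0 else 0)"
        unfolding block_kraus_apply[OF U] block_kraus_apply[OF V] by (intro sum.cong refl) auto
      then show ?thesis by simp
    qed
    have "cinner max_entangled (tensor_op (?A (Inl i)) (?B (Inl i)) *v \<phi>)
      = of_real (1 / sqrt (real ?D)) * of_real (\<Sum>s\<in>UNIV. if h s = i then w s else 0)"
      unfolding \<phi> max_entangled_overlap of_real_sum *
      by (intro arg_cong2[where f = "(*)"] refl sum.cong) simp
    moreover have "(\<Sum>s\<in>UNIV. if h s = i then w s else 0) = block_sum ?D (w \<circ> b) ?T i"
      unfolding block_sum_def sum.reindex_bij_betw[OF b, symmetric]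
      by (intro sum.cong refl) (simp add: h_def idx_b)
    ultimately show ?thesis
      by (simp add: norm_mult norm_divide power_mult_distrib power_divide)
  qed
  have "1 / real ?D * (\<Sum>i<?T. (block_sum ?D (w \<circ> b) ?T i)\<^sup>2) = (\<Sum>i<?T. ?f (Inl i) (Inl i))"
    by (simp only: diag sum_distrib_left)
  also have "\<dots> \<le> (\<Sum>i<?T. \<Sum>c\<in>({..<?T} <+> UNIV). ?f (Inl i) c)"
  proof (rule sum_mono)
    fix i assume "i \<in> {..<?T}"
    then show "?f (Inl i) (Inl i) \<le> (\<Sum>c\<in>({..<?T} <+> UNIV). ?f (Inl i) c)"
      by (intro member_le_sum) auto
  qed
  also have "\<dots> = (\<Sum>a\<in>Inl ` {..<?T}. \<Sum>c\<in>({..<?T} <+> UNIV). ?f a c)"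
    by (subst sum.reindex) (auto simp: inj_on_def)
  also have "\<dots> \<le> (\<Sum>a\<in>({..<?T} <+> UNIV). \<Sum>c\<in>({..<?T} <+> UNIV). ?f a c)"
    by (intro sum_mono2) (auto intro: sum_nonneg)
  also have "\<dots> = Re (cinner max_entangled (tensor_map ?E ?F (ketbra \<phi>) *v max_entangled))"
    by (rule fidelity_kraus[symmetric]) (rule refl)+
  finally have "1 / real ?D * (\<Sum>i<?T. (block_sum ?D (w \<circ> b) ?T i)\<^sup>2)
    \<le> Re (cinner max_entangled (tensor_map ?E ?F (ketbra \<phi>) *v max_entangled))" .
  moreover have "quantum_channel ?E" "quantum_channel ?F"
    by (intro quantum_channel_kraus_map block_kraus_family U V h inj; assumption)+
  ultimately show ?thesis using that by blast
qed

subsection \<open>Tensor powers\<close>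

lemma prod_if_eq:
  fixes c :: "'c::comm_semiring_1" and f g :: "'k::finite \<Rightarrow> 'a"
  shows "(\<Prod>k\<in>UNIV. if f k = g k then c else 0) = (if f = g then c ^ CARD('k) else 0)"
proof (cases "f = g")
  case False
  then obtain k where "f k \<noteq> g k" by auto
  then have "(\<Prod>k\<in>UNIV. if f k = g k then c else 0) = 0" by (intro prod_zero) auto
  with False show ?thesis by simp
qed simp

lemma max_entangled_nth:
  "(max_entangled :: complex ^ ('d::finite \<times> 'd)) $ (a, b)
    = (if a = b then of_real (1 / sqrt (real CARD('d))) else 0)"
proof -
  have "(\<Sum>i\<in>UNIV. tensor_vec (axis i 1) (axis i 1) :: complex ^ ('d \<times> 'd)) $ (a, b)
      = (\<Sum>i\<in>UNIV. if i = a then if a = b then 1 else 0 else 0)"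
    unfolding sum_component by (intro sum.cong refl) (auto simp: tensor_vec_def axis_def)
  then show ?thesis
    by (simp add: max_entangled_def scaleR_conv_of_real[where 'a = complex])
qed

text \<open>Makes the target a single maximally entangled state with local basis
  \<open>'m \<Rightarrow> 'd\<close>, to which the fidelity bounds apply directly.\<close>

lemma bipartite_power_max_entangled:
  "(bipartite_power (max_entangled :: complex ^ ('d::finite \<times> 'd))
      :: complex ^ (('m::finite \<Rightarrow> 'd) \<times> ('m \<Rightarrow> 'd))) = max_entangled"
proof -
  have "(\<Prod>k\<in>UNIV. if f k = g k then of_real (1 / sqrt (real CARD('d))) else 0)
      = (if f = g then complex_of_real (1 / sqrt (real CARD('m \<Rightarrow> 'd))) else 0)" for f g :: "'m \<Rightarrow> 'd"
    unfolding prod_if_eq by (simp add: card_fun real_sqrt_power power_one_over)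
  then show ?thesis
    unfolding vec_eq_iff split_paired_all
    by (simp add: bipartite_power_def max_entangled_nth)
qed

text \<open>The factors may differ: the Schmidt vectors of a power mix all single-copy ones.\<close>

definition tensor_power_vec :: "('n::finite \<Rightarrow> complex ^ 'a::finite) \<Rightarrow> complex ^ ('n \<Rightarrow> 'a)" where
  "tensor_power_vec u = (\<chi> f. \<Prod>k\<in>UNIV. u k $ f k)"

lemma prod_sum_UNIV:
  fixes f :: "'n::finite \<Rightarrow> 'i::finite \<Rightarrow> 'c::comm_semiring_1"
  shows "(\<Prod>k\<in>UNIV. \<Sum>i\<in>UNIV. f k i) = (\<Sum>s\<in>UNIV. \<Prod>k\<in>UNIV. f k (s k))"
  using prod_sum_PiE[of UNIV "\<lambda>_. UNIV" f] by simp

lemma cinner_tensor_power_vec: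
  "cinner (tensor_power_vec u) (tensor_power_vec v) = (\<Prod>k\<in>UNIV. cinner (u k) (v k))"
  by (simp add: cinner_def tensor_power_vec_def prod_sum_UNIV prod.distrib)

lemma orthonormal_tensor_power:
  assumes "orthonormal_family u"
  shows "orthonormal_family (\<lambda>s. tensor_power_vec (\<lambda>k. u (s k)))"
proof -
  have u: "cinner (u i) (u j) = (if i = j then 1 else 0)" for i j
    using assms by (simp add: orthonormal_family_def)
  show ?thesis
    unfolding orthonormal_family_def cinner_tensor_power_vec u prod_if_eq by simp
qed

text \<open>Distributing the product over the sums leaves one term for each word
  \<open>s\<close>.\<close>

lemma bipartite_power_schmidt:
  fixes w :: "'s::finite \<Rightarrow> real"
  assumes "\<psi> = (\<Sum>i\<in>UNIV. w i *\<^sub>R tensor_vec (u i) (v i))"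
  shows "bipartite_power \<psi> = (\<Sum>s\<in>UNIV. (\<Prod>k\<in>UNIV. w (s k)) *\<^sub>R
    tensor_vec (tensor_power_vec (\<lambda>k. u (s k))) (tensor_power_vec (\<lambda>k. v (s k))))"
  unfolding vec_eq_iff assms
  by (simp add: bipartite_power_def tensor_power_vec_def tensor_vec_def prod_sum_UNIV prod.distrib
      scaleR_conv_of_real[where 'a = complex] mult.assoc)

text \<open>The rows are multiples of distinct basis vectors. This is what turns
  \<open>rank P\<close> into a count of nonzero Schmidt coefficients.\<close>

lemma rank_diagonal:
  fixes p :: "'s::finite \<Rightarrow> real"
  shows "rank (\<chi> i j. if i = j then p i else 0 :: real ^ 's ^ 's) = card {i. p i \<noteq> 0}"
proof -
  let ?P = "\<chi> i j. if i = j then p i else 0 :: real ^ 's ^ 's"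
  let ?B = "(\<lambda>i. axis i 1 :: real ^ 's) ` {i. p i \<noteq> 0}"
  have row: "row i ?P = p i *\<^sub>R axis i 1" for i
    by (auto simp: row_def vec_eq_iff axis_def)
  have "independent ?B"
    by (rule independent_mono[OF independent_Basis]) (auto simp: Basis_vec_def)
  moreover have "span ?B = span (rows ?P)"
    unfolding span_eq
  proof (intro conjI subsetI)
    fix x assume "x \<in> ?B"
    then obtain i where i: "p i \<noteq> 0" "x = axis i 1" by auto
    then have "x = (1 / p i) *\<^sub>R row i ?P" by (simp add: row)
    moreover have "row i ?P \<in> span (rows ?P)" by (rule span_base) (auto simp: rows_def)
    ultimately show "x \<in> span (rows ?P)" by (simp only: span_scale)
  next
    fix x assume "x \<in> rows ?P"
    then obtain i where "x = p i *\<^sub>R axis i 1" by (auto simp: rows_def row)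
    then show "x \<in> span ?B"
    proof (cases "p i = 0")
      case False
      then have "axis i 1 \<in> span ?B" by (intro span_base) auto
      with \<open>x = _\<close> show ?thesis by (simp only: span_scale)
    qed (simp add: span_zero)
  qed
  ultimately have "dim (rows ?P) = card ?B" by (intro dim_eq_card)
  also have "card ?B = card {i. p i \<noteq> 0}"
    by (rule card_image) (auto simp: inj_on_def axis_eq_axis)
  finally show ?thesis by (simp add: row_rank_def)
qed

lemma card_prod_nonzero:
  fixes p :: "'s::finite \<Rightarrow> real"
  shows "card {s :: 'n::finite \<Rightarrow> 's. (\<Prod>k\<in>UNIV. p (s k)) \<noteq> 0} = card {i. p i \<noteq> 0} ^ CARD('n)"
proof -
  have "{s :: 'n \<Rightarrow> 's. (\<Prod>k\<in>UNIV. p (s k)) \<noteq> 0} = PiE UNIV (\<lambda>_. {i. p i \<noteq> 0})"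
    by (auto simp: PiE_def Pi_def)
  then show ?thesis by (simp add: card_PiE)
qed

text \<open>Entries from \<open>r\<close> on vanish, so a block may be cut at \<open>r\<close>, as
  in the definition of \<open>\<alpha>\<close>, although \<open>block_sum\<close> runs over all
  \<open>T\<close> entries.\<close>

lemma block_sum_interval:
  assumes "D > 0" "r \<le> T" "\<And>j. r \<le> j \<Longrightarrow> j < T \<Longrightarrow> v j = 0"
  shows "block_sum D v T i = (\<Sum>j\<in>{i * D..<min (Suc i * D) r}. v j)"
proof -
  have "j div D = i \<longleftrightarrow> i * D \<le> j \<and> j < Suc i * D" for j
    unfolding less_eq_div_iff_mult_less_eq[OF assms(1), symmetric]
      div_less_iff_less_mult[OF assms(1), symmetric] by auto
  then have "block_sum D v T i = (\<Sum>j\<in>{j\<in>{..<T}. i * D \<le> j \<and> j < Suc i * D}. v j)"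
    unfolding block_sum_def by (subst sum.inter_filter) auto
  also have "\<dots> = (\<Sum>j\<in>{i * D..<min (Suc i * D) r}. v j)"
    by (rule sum.mono_neutral_right) (use assms in auto)
  finally show ?thesis .
qed

lemma block_sum_antimono:
  assumes "D > 0" "\<And>i j. i \<le> j \<Longrightarrow> j < T \<Longrightarrow> v j \<le> v i" "\<And>j. j < T \<Longrightarrow> 0 \<le> v j" "k \<le> i"
  shows "block_sum D v T i \<le> block_sum D v T k"
proof -
  \<comment> \<open>Padding with zeros gives every block exactly \<open>D\<close> terms, so two
    blocks compare term by term even when one is cut off.\<close>
  define v' where "v' j = (if j < T then v j else 0)" for j
  have *: "block_sum D v T i = (\<Sum>t<D. v' (i * D + t))" for i
  proof -
    have "block_sum D v T i = (\<Sum>j\<in>{i * D..<min (Suc i * D) T}. v j)"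
      using assms by (intro block_sum_interval) auto
    also have "\<dots> = (\<Sum>j\<in>{i * D..<min (Suc i * D) T}. v' j)"
      by (intro sum.cong) (auto simp: v'_def)
    also have "\<dots> = (\<Sum>j\<in>{0 + i * D..<D + i * D}. v' j)"
      by (rule sum.mono_neutral_left) (auto simp: v'_def)
    also have "\<dots> = (\<Sum>t\<in>{0..<D}. v' (t + i * D))" by (rule sum.shift_bounds_nat_ivl)
    finally show ?thesis by (simp add: add.commute atLeast0LessThan)
  qed
  have "v' (i * D + t) \<le> v' (k * D + t)" for t
  proof -
    have le: "k * D + t \<le> i * D + t" using assms(4) by simp
    show ?thesis
    proof (cases "i * D + t < T")
      case True
      then have "k * D + t < T" using le by linarith
      with assms(2)[OF le True] True show ?thesis by (simp add: v'_def)
    qed (use assms(3) in \<open>simp add: v'_def\<close>)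
  qed
  then show ?thesis unfolding * by (rule sum_mono)
qed

lemma lookup_scaleR: "Poly_Mapping.lookup (r *\<^sub>R p) i = r * Poly_Mapping.lookup p i"
  for p :: "'a \<Rightarrow>\<^sub>0 real"
  unfolding scaleR_poly_mapping_def
  by (subst lookup_Abs_poly_mapping) (auto intro: finite_subset[OF _ finite_lookup[of p]])

subsection \<open>The optimization program\<close>

lemma decreasing_distributionsD:
  assumes "p \<in> decreasing_distributions N"
  shows "Poly_Mapping.keys p \<subseteq> {1..N}" "\<And>i. i \<in> {1..N} \<Longrightarrow> 0 \<le> Poly_Mapping.lookup p i"
    "(\<Sum>i=1..N. Poly_Mapping.lookup p i) = 1"
    "\<And>i. 1 \<le> i \<and> i < N \<Longrightarrow> Poly_Mapping.lookup p (Suc i) \<le> Poly_Mapping.lookup p i"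
  using assms unfolding decreasing_distributions_def by blast+

lemma decreasing_distributions_convex: "convex (decreasing_distributions N)"
  unfolding convex_def
proof (intro ballI allI impI)
  fix p q :: "nat \<Rightarrow>\<^sub>0 real" and u v :: real
  assume p: "p \<in> decreasing_distributions N" and q: "q \<in> decreasing_distributions N"
    and uv: "0 \<le> u" "0 \<le> v" "u + v = 1"
  note P = decreasing_distributionsD[OF p] and Q = decreasing_distributionsD[OF q]
  let ?z = "u *\<^sub>R p + v *\<^sub>R q"
  have l: "Poly_Mapping.lookup ?z i = u * Poly_Mapping.lookup p i + v * Poly_Mapping.lookup q i" for i
    by (simp add: lookup_add lookup_scaleR)
  show "?z \<in> decreasing_distributions N"
    unfolding decreasing_distributions_def mem_Collect_eq
  proof (intro conjI ballI allI impI)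
    have "Poly_Mapping.lookup ?z i = 0" if "i \<notin> {1..N}" for i
    proof -
      have "i \<notin> Poly_Mapping.keys p" "i \<notin> Poly_Mapping.keys q"
        using P(1) Q(1) that by blast+
      then show ?thesis unfolding l by (simp add: in_keys_iff)
    qed
    then show "Poly_Mapping.keys ?z \<subseteq> {1..N}" unfolding subset_iff in_keys_iff by blast
    show "0 \<le> Poly_Mapping.lookup ?z i" if "i \<in> {1..N}" for i
      unfolding l using P(2)[OF that] Q(2)[OF that] uv by simp
    show "(\<Sum>i = 1..N. Poly_Mapping.lookup ?z i) = 1"
      unfolding l sum.distrib sum_distrib_left[symmetric] P(3) Q(3) using uv by simp
    show "Poly_Mapping.lookup ?z (Suc i) \<le> Poly_Mapping.lookup ?z i" if "1 \<le> i \<and> i < N" for i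
      unfolding l by (intro add_mono mult_left_mono P(4) Q(4) that uv)
  qed
qed

lemma sqrt_concave:
  assumes "0 \<le> x" "0 \<le> y" "0 \<le> u" "0 \<le> v" "u + v = 1"
  shows "u * sqrt x + v * sqrt y \<le> sqrt (u * x + v * y)"
proof (rule real_le_rsqrt)
  \<comment> \<open>With \<open>u + v = 1\<close> the right side is the mean of \<open>x\<close> and
    \<open>y\<close>; the added square is the nonnegative Jensen gap.\<close>
  have "(u * sqrt x + v * sqrt y)\<^sup>2 + u * v * (sqrt x - sqrt y)\<^sup>2
      = (u + v) * (u * (sqrt x)\<^sup>2 + v * (sqrt y)\<^sup>2)" by algebra
  also have "\<dots> = u * x + v * y" using assms by simp
  finally show "(u * sqrt x + v * sqrt y)\<^sup>2 \<le> u * x + v * y"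
    using assms by (smt (verit) mult_nonneg_nonneg zero_le_power2)
qed

lemma convex_on_objective:
  assumes "\<And>i. i \<in> I \<Longrightarrow> 0 \<le> a i" "I \<subseteq> {1..N}"
  shows "convex_on (decreasing_distributions N) (\<lambda>p. - (\<Sum>i\<in>I. a i * sqrt (Poly_Mapping.lookup p i)))"
  unfolding convex_on_def
proof (intro conjI decreasing_distributions_convex ballI allI impI)
  fix p q and u v :: real
  assume p: "p \<in> decreasing_distributions N" and q: "q \<in> decreasing_distributions N"
    and uv: "0 \<le> u" "0 \<le> v" "u + v = 1"
  let ?l = "Poly_Mapping.lookup"
  have "(\<Sum>i\<in>I. a i * (u * sqrt (?l p i) + v * sqrt (?l q i)))
    \<le> (\<Sum>i\<in>I. a i * sqrt (?l (u *\<^sub>R p + v *\<^sub>R q) i))"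
  proof (intro sum_mono mult_left_mono assms(1))
    fix i assume "i \<in> I"
    then have "i \<in> {1..N}" using assms(2) by blast
    then have "0 \<le> ?l p i" "0 \<le> ?l q i" using decreasing_distributionsD(2)[OF p] decreasing_distributionsD(2)[OF q] by blast+
    then show "u * sqrt (?l p i) + v * sqrt (?l q i) \<le> sqrt (?l (u *\<^sub>R p + v *\<^sub>R q) i)"
      using sqrt_concave uv by (simp add: lookup_add lookup_scaleR)
  qed
  then show "- (\<Sum>i\<in>I. a i * sqrt (?l (u *\<^sub>R p + v *\<^sub>R q) i))
    \<le> u * - (\<Sum>i\<in>I. a i * sqrt (?l p i)) + v * - (\<Sum>i\<in>I. a i * sqrt (?l q i))"
    by (simp add: algebra_simps sum.distrib sum_distrib_left)
qed

lemma objective_minimum: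
  fixes a :: "nat \<Rightarrow> real"
  assumes a: "\<And>i. i \<in> {1..K} \<Longrightarrow> 0 \<le> a i" "\<And>i j. 1 \<le> i \<Longrightarrow> i \<le> j \<Longrightarrow> j \<le> K \<Longrightarrow> a j \<le> a i"
    and K: "K \<le> N" and S: "(\<Sum>i=1..K. (a i)\<^sup>2) > 0"
  defines "objective \<equiv> \<lambda>p. - (\<Sum>i=1..K. a i * sqrt (Poly_Mapping.lookup p i))"
  obtains p where "p \<in> decreasing_distributions N" "objective p = - sqrt (\<Sum>i=1..K. (a i)\<^sup>2)"
    "\<And>q. q \<in> decreasing_distributions N \<Longrightarrow> objective p \<le> objective q"
proof -
  let ?S = "\<Sum>i=1..K. (a i)\<^sup>2"
  let ?l = "Poly_Mapping.lookup"
  define f where "f i = (if i \<in> {1..K} then (a i)\<^sup>2 / ?S else 0)" for i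
  define p where "p = Abs_poly_mapping f"
  have l: "?l p = f"
    unfolding p_def by (rule lookup_Abs_poly_mapping) (rule finite_subset[of _ "{1..K}"], auto simp: f_def)
  have p: "p \<in> decreasing_distributions N"
    unfolding decreasing_distributions_def mem_Collect_eq l
  proof (intro conjI ballI allI impI)
    show "Poly_Mapping.keys p \<subseteq> {1..N}"
      using K by (auto simp: in_keys_iff l f_def split: if_splits)
    show "0 \<le> f i" for i using S by (simp add: f_def)
    have "(\<Sum>i=1..N. f i) = (\<Sum>i=1..K. f i)"
      by (rule sum.mono_neutral_right) (use K in \<open>auto simp: f_def\<close>)
    also have "\<dots> = (\<Sum>i=1..K. (a i)\<^sup>2 / ?S)" by (rule sum.cong) (auto simp: f_def)
    also have "\<dots> = 1" using S by (simp flip: sum_divide_distrib)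
    finally show "(\<Sum>i=1..N. f i) = 1" .
    show "f (Suc i) \<le> f i" if "1 \<le> i \<and> i < N" for i
    \<comment> \<open>Beyond \<open>K\<close> the weight drops to zero, so squares are compared only
      inside \<open>{1..K}\<close>.\<close>
    proof (cases "Suc i \<le> K")
      case True
      then have "(a (Suc i))\<^sup>2 \<le> (a i)\<^sup>2" using that a by (intro power_mono) auto
      then show ?thesis using True that S by (auto simp: f_def divide_right_mono)
    qed (use S in \<open>auto simp: f_def\<close>)
  qed
  have "(\<Sum>i=1..K. a i * sqrt (f i)) = (\<Sum>i=1..K. (a i)\<^sup>2 / sqrt ?S)"
    using a(1) by (intro sum.cong refl) (auto simp: f_def real_sqrt_divide power2_eq_square)
  also have "\<dots> = sqrt ?S"
    using S by (simp add: real_div_sqrt flip: sum_divide_distrib)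
  finally have op: "objective p = - sqrt ?S" by (simp add: objective_def l)
  have "objective p \<le> objective q" if q: "q \<in> decreasing_distributions N" for q
  proof -
    have q0: "0 \<le> ?l q i" if "i \<in> {1..N}" for i
      by (rule decreasing_distributionsD(2)[OF q that])
    have "(\<Sum>i=1..K. a i * sqrt (?l q i)) = (\<Sum>i=1..K. \<bar>a i\<bar> * \<bar>sqrt (?l q i)\<bar>)"
      using a(1) q0 K by (intro sum.cong) auto
    also have "\<dots> \<le> L2_set a {1..K} * L2_set (\<lambda>i. sqrt (?l q i)) {1..K}" by (rule L2_set_mult_ineq)
    also have "\<dots> \<le> sqrt ?S * 1"
    proof -
      \<comment> \<open>Only the mass that \<open>q\<close> puts on \<open>{1..K}\<close> enters, so
        the second norm is at most 1.\<close>
      have "(\<Sum>i=1..K. (sqrt (?l q i))\<^sup>2) = (\<Sum>i=1..K. ?l q i)"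
        using q0 K by (intro sum.cong) auto
      also have "\<dots> \<le> (\<Sum>i=1..N. ?l q i)" using q0 K by (intro sum_mono2) auto
      also have "\<dots> = 1" by (rule decreasing_distributionsD(3)[OF q])
      finally show ?thesis unfolding L2_set_def using S by (intro mult_left_mono) auto
    qed
    finally show ?thesis unfolding op by (simp add: objective_def)
  qed
  with p op that show ?thesis by blast
qed

lemma sqrt_prod: "sqrt (prod f A) = (\<Prod>i\<in>A. sqrt (f i))"
  by (induction A rule: infinite_finite_induct) (simp_all add: real_sqrt_mult)

text \<open>The first two conjuncts say that the supremum in \<open>F_LO\<close> and the infimum
  over distributions are attained, so both are a genuine maximum and minimum. The proof works with
  zero-based blocks of all \<open>T\<close> Schmidt coefficients of the source, vanishing ones
  included, and trims them to the rank.\<close>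

theorem theorem8:
  fixes \<psi> :: "complex ^ ('a::finite \<times> 'b::finite)"
    and P :: "real ^ 's::finite ^ 's"
    and d m n N :: nat
    and pn \<alpha> :: "nat \<Rightarrow> real"
    and I :: "nat set"
    and objective :: "(nat \<Rightarrow>\<^sub>0 real) \<Rightarrow> real"
    and source :: "complex ^ (('n::finite \<Rightarrow> 'a) \<times> ('n \<Rightarrow> 'b))"
    and target :: "complex ^ (('m::finite \<Rightarrow> 'd::finite) \<times> ('m \<Rightarrow> 'd))"
  assumes "pure_state \<psi>" and "schmidt_distribution \<psi> P"
  defines "d \<equiv> CARD('d)" and "m \<equiv> CARD('m)" and "n \<equiv> CARD('n)"
  defines "source \<equiv> bipartite_power \<psi>" and "target \<equiv> bipartite_power max_entangled"
  defines "pn \<equiv> decreasing_diag (mat_power P :: real ^ ('n \<Rightarrow> 's) ^ ('n \<Rightarrow> 's))"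
  defines "N \<equiv> d ^ m * rank P ^ n"
  defines "I \<equiv> {1..nat \<lceil>real (rank P ^ n) / real (d ^ m)\<rceil>}"
  defines "\<alpha> \<equiv> \<lambda>i. \<Sum>j = (i - 1) * d ^ m + 1..min (i * d ^ m) (rank P ^ n). sqrt (pn j)"
  defines "objective \<equiv> \<lambda>p. - (\<Sum>i\<in>I. \<alpha> i * sqrt (Poly_Mapping.lookup p i))"
  shows "(\<exists>f\<in>lo_fidelities target source. \<forall>g\<in>lo_fidelities target source. g \<le> f)
    \<and> (\<exists>p\<in>decreasing_distributions N. \<forall>q\<in>decreasing_distributions N. objective p \<le> objective q)
    \<and> F_LO target source =
        1 / real d ^ m * (INF p\<in>decreasing_distributions N. objective p)\<^sup>2
    \<and> convex (decreasing_distributions N)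
    \<and> convex_on (decreasing_distributions N) objective"
proof -
  obtain p u v where "schmidt_decomposition \<psi> p u v" and P: "P = (\<chi> i j. if i = j then p i else 0)"
    using assms(2) unfolding schmidt_distribution_def by blast
  then have p: "\<And>i. 0 \<le> p i" "(\<Sum>i\<in>UNIV. p i) = 1" and u: "orthonormal_family u" and v: "orthonormal_family v"
    and \<psi>: "\<psi> = (\<Sum>i\<in>UNIV. sqrt (p i) *\<^sub>R tensor_vec (u i) (v i))"
    unfolding schmidt_decomposition_def by auto
  define q :: "('n \<Rightarrow> 's) \<Rightarrow> real" where "q s = (\<Prod>k\<in>UNIV. p (s k))" for s
  define w where "w s = sqrt (q s)" for s
  define U where "U s = tensor_power_vec (\<lambda>k. u (s k))" for s :: "'n \<Rightarrow> 's"
  define V where "V s = tensor_power_vec (\<lambda>k. v (s k))" for s :: "'n \<Rightarrow> 's"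
  define D where "D = CARD('m \<Rightarrow> 'd)"
  define T where "T = CARD('n \<Rightarrow> 's)"
  define r where "r = rank P ^ n"
  have q0: "0 \<le> q s" for s unfolding q_def by (intro prod_nonneg) (simp add: p)
  then have w0: "0 \<le> w s" for s by (simp add: w_def)
  have UV: "orthonormal_family U" "orthonormal_family V"
    unfolding U_def V_def using u v by (auto intro: orthonormal_tensor_power)
  have "(\<Prod>k\<in>UNIV. sqrt (p (s k))) = w s" for s :: "'n \<Rightarrow> 's"
    unfolding w_def q_def by (simp add: sqrt_prod)
  then have source: "source = (\<Sum>s\<in>UNIV. w s *\<^sub>R tensor_vec (U s) (V s))"
    unfolding source_def bipartite_power_schmidt[OF \<psi>] U_def V_def by simp
  have target: "target = max_entangled"
    unfolding target_def by (rule bipartite_power_max_entangled)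
  have D: "D = d ^ m" "0 < D" by (simp_all add: D_def d_def m_def card_fun)
  have r_card: "r = card {s. q s \<noteq> 0}"
    unfolding r_def P rank_diagonal n_def q_def by (rule card_prod_nonzero[symmetric])
  have rT: "r \<le> T" unfolding r_card T_def by (rule card_mono) auto
  have r0: "0 < r"
  proof -
    obtain i where "p i \<noteq> 0" using p(2) by force
    then have "0 < card {i. p i \<noteq> 0}" by (auto simp: card_gt_0_iff)
    then show ?thesis by (simp add: r_def P rank_diagonal)
  qed
  obtain b where b: "bij_betw b {..<T} UNIV" "\<And>i j. i \<le> j \<Longrightarrow> j < T \<Longrightarrow> q (b j) \<le> q (b i)"
    and qb: "map (q \<circ> b) [0..<T] = rev (sorted_list_of_multiset (image_mset q (mset_set UNIV)))"
    unfolding T_def by (rule decreasing_enumeration[of "UNIV :: ('n \<Rightarrow> 's) set" q]) simp_all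
  have wb: "w (b j) \<le> w (b i)" if "i \<le> j" "j < T" for i j
    using b(2)[OF that] by (simp add: w_def)
  have diag: "mat_power P $ s $ s = q s" for s :: "'n \<Rightarrow> 's"
    by (simp add: mat_power_def P q_def)
  \<comment> \<open>\<open>pn\<close> counts from 1 and \<open>b\<close> from 0, hence the
    \<open>Suc\<close>.\<close>
  have pn: "sqrt (pn (Suc j)) = w (b j)" if "j < T" for j
  proof -
    have "pn (Suc j) = map (q \<circ> b) [0..<T] ! j"
      unfolding pn_def decreasing_diag_def diag qb by simp
    then show ?thesis using that by (simp add: w_def)
  qed
  \<comment> \<open>A nonzero coefficient at position \<open>j\<close> would, by monotonicity, make
    all \<open>Suc j\<close> leading ones nonzero, more than there are.\<close>
  have w_zero: "w (b j) = 0" if "r \<le> j" "j < T" for j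
  proof (rule ccontr)
    assume "w (b j) \<noteq> 0"
    then have "q (b j) > 0" using q0[of "b j"] by (auto simp: w_def)
    then have "b ` {..j} \<subseteq> {s. q s \<noteq> 0}" using b(2) that by fastforce
    moreover have "inj_on b {..j}" using b(1) that by (auto simp: bij_betw_def inj_on_def)
    ultimately have "Suc j \<le> r" unfolding r_card by (metis card_mono card_image card_atMost finite)
    with that show False by simp
  qed
  let ?B = "block_sum D (w \<circ> b) T"
  have B: "?B i = (\<Sum>j\<in>{i * D..<min (Suc i * D) r}. w (b j))" for i
    using block_sum_interval[of D r T "w \<circ> b" i] D(2) rT w_zero by simp
  have \<alpha>: "\<alpha> (Suc i) = ?B i" for i
  proof -
    have "\<alpha> (Suc i) = (\<Sum>j\<in>{Suc (i * D)..<Suc (min (Suc i * D) r)}. sqrt (pn j))"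
      unfolding \<alpha>_def D(1)[symmetric] r_def[symmetric] by (intro sum.cong) auto
    also have "\<dots> = (\<Sum>j\<in>{i * D..<min (Suc i * D) r}. sqrt (pn (Suc j)))"
      by (rule sum.shift_bounds_Suc_ivl)
    also have "\<dots> = ?B i"
      unfolding B using rT by (intro sum.cong refl pn) auto
    finally show ?thesis .
  qed
  define K where "K = nat \<lceil>real r / real D\<rceil>"
  have IK: "I = {1..K}" by (simp add: I_def K_def r_def D(1))
  \<comment> \<open>Rounding up in \<open>K\<close> makes \<open>K\<close> blocks of length
    \<open>D\<close> cover all nonzero coefficients.\<close>
  have rK: "r \<le> K * D"
  proof -
    have "real r / real D \<le> real K" unfolding K_def by (rule real_nat_ceiling_ge)
    then have "real r \<le> real (K * D)" using D(2) by (simp add: field_simps)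
    then show ?thesis by linarith
  qed
  have Kr: "K \<le> r"
  proof -
    have "real r * 1 \<le> real r * real D" using D(2) by (intro mult_left_mono) auto
    then have "real r / real D \<le> real r" using D(2) by (simp add: divide_le_eq)
    then show ?thesis unfolding K_def by (simp add: nat_le_iff ceiling_le_iff)
  qed
  have K0: "0 < K" using rK r0 by (cases K) auto
  \<comment> \<open>The alphabet leaves room for all of \<open>I\<close>, so the minimiser is
    admissible.\<close>
  have KN: "K \<le> N"
  proof -
    have "1 * r \<le> D * r" using D(2) by (intro mult_right_mono) auto
    then show ?thesis using Kr unfolding N_def D(1)[symmetric] r_def[symmetric] by linarith
  qed
  have B0: "0 \<le> ?B i" for i unfolding B by (intro sum_nonneg w0)
  have B_mono: "?B j \<le> ?B i" if "i \<le> j" for i j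
    by (rule block_sum_antimono) (use D wb w0 that in auto)
  have \<alpha>0: "0 \<le> \<alpha> i" if "i \<in> {1..K}" for i
    using that \<alpha>[of "i - 1"] B0[of "i - 1"] by simp
  have \<alpha>_mono: "\<alpha> j \<le> \<alpha> i" if "1 \<le> i" "i \<le> j" for i j
    using that \<alpha>[of "i - 1"] \<alpha>[of "j - 1"] B_mono[of "i - 1" "j - 1"] by simp
  let ?S = "\<Sum>i=1..K. (\<alpha> i)\<^sup>2"
  have S: "?S = (\<Sum>i<T. (?B i)\<^sup>2)"
  proof -
    have "?S = (\<Sum>i<K. (?B i)\<^sup>2)"
      using \<alpha> sum.shift_bounds_Suc_ivl[of "\<lambda>i. (\<alpha> i)\<^sup>2" 0 K]
      by (simp add: atLeastLessThanSuc_atLeastAtMost atLeast0LessThan)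
    also have "\<dots> = (\<Sum>i<T. (?B i)\<^sup>2)"
    proof (rule sum.mono_neutral_left)
      show "\<forall>i\<in>{..<T} - {..<K}. (?B i)\<^sup>2 = 0"
      proof
        \<comment> \<open>Such a block starts at or beyond \<open>r\<close>, so its interval is
          empty.\<close>
        fix i assume "i \<in> {..<T} - {..<K}"
        then have "K * D \<le> i * D" by simp
        then have "r \<le> i * D" using rK by linarith
        then show "(?B i)\<^sup>2 = 0" unfolding B by simp
      qed
    qed (use Kr rT in auto)
    finally show ?thesis .
  qed
  \<comment> \<open>Needed to normalise the minimiser; the largest coefficient is nonzero and lies
    in the first block.\<close>
  have S0: "?S > 0"
  proof -
    obtain s where "q s \<noteq> 0" using r0 unfolding r_card by (auto simp: card_gt_0_iff)
    then have "w s > 0" using q0[of s] by (simp add: w_def)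
    moreover obtain j where "j < T" "s = b j" using b(1) by (auto simp: bij_betw_def)
    ultimately have "w (b 0) > 0" using wb[of 0 j] by simp
    moreover have "w (b 0) \<le> ?B 0"
      unfolding B by (rule member_le_sum) (use D r0 w0 in auto)
    ultimately have "\<alpha> 1 > 0" using \<alpha>[of 0] by simp
    then have "0 < (\<alpha> 1)\<^sup>2" by simp
    also have "\<dots> \<le> ?S" by (rule member_le_sum) (use K0 in auto)
    finally show ?thesis .
  qed
  obtain p\<^sub>0 where p\<^sub>0: "p\<^sub>0 \<in> decreasing_distributions N" "objective p\<^sub>0 = - sqrt ?S"
    "\<And>q. q \<in> decreasing_distributions N \<Longrightarrow> objective p\<^sub>0 \<le> objective q"
    unfolding objective_def IK using objective_minimum[OF \<alpha>0 \<alpha>_mono KN S0] by blast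
  \<comment> \<open>The minimum is negative; squaring removes sign and root and leaves
    \<open>?S\<close>.\<close>
  have INF: "(INF p\<in>decreasing_distributions N. objective p) = - sqrt ?S"
    unfolding p\<^sub>0(2)[symmetric] by (rule cInf_eq_minimum) (use p\<^sub>0(1,3) in blast)+
  let ?F = "1 / real D * ?S"
  have upper: "g \<le> ?F" if "g \<in> lo_fidelities target source" for g
  proof -
    from that obtain E F where E: "quantum_channel E" and F: "quantum_channel F"
      and g: "g = Re (cinner target (tensor_map E F (ketbra source) *v target))"
      unfolding lo_fidelities_def by blast
    show ?thesis
      unfolding g target S unfolding D_def T_def
      by (rule fidelity_upper_bound[OF E F UV b(1)[unfolded T_def] wb[unfolded T_def] w0 source])
  qed
  have mem: "?F \<in> lo_fidelities target source"
  proof -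
    obtain E :: "complex ^ ('n \<Rightarrow> 'a) ^ ('n \<Rightarrow> 'a) \<Rightarrow> complex ^ ('m \<Rightarrow> 'd) ^ ('m \<Rightarrow> 'd)"
      and F :: "complex ^ ('n \<Rightarrow> 'b) ^ ('n \<Rightarrow> 'b) \<Rightarrow> complex ^ ('m \<Rightarrow> 'd) ^ ('m \<Rightarrow> 'd)"
      where E: "quantum_channel E" and F: "quantum_channel F"
      and le: "?F \<le> Re (cinner max_entangled (tensor_map E F (ketbra source) *v max_entangled))"
      unfolding S unfolding D_def T_def
      by (rule fidelity_attained[OF UV b(1)[unfolded T_def] source])
    \<comment> \<open>These channels reach at least \<open>?F\<close> and \<open>upper\<close>
      allows no more, so \<open>?F\<close> itself is a fidelity and the supremum is a
      maximum.\<close>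
    let ?g = "Re (cinner target (tensor_map E F (ketbra source) *v target))"
    have "?g \<in> lo_fidelities target source" unfolding lo_fidelities_def using E F by blast
    moreover from upper[OF this] have "?g = ?F" using le unfolding target by linarith
    ultimately show ?thesis by simp
  qed
  have "F_LO target source = ?F"
    unfolding F_LO_def by (rule cSup_eq_maximum[OF mem upper])
  also have "\<dots> = 1 / real d ^ m * (INF p\<in>decreasing_distributions N. objective p)\<^sup>2"
    using S0 unfolding INF by (simp add: D(1))
  finally have F_LO: "F_LO target source
      = 1 / real d ^ m * (INF p\<in>decreasing_distributions N. objective p)\<^sup>2" .
  have "convex_on (decreasing_distributions N) objective"
    unfolding objective_def by (rule convex_on_objective) (use \<alpha>0 KN in \<open>auto simp: IK\<close>)
  with F_LO mem upper p\<^sub>0 decreasing_distributions_convex show ?thesis by blast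
qed

end
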